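(* Let $P_1,\dots,P_n$ and $Q_1,\dots,Q_n$ be convex polytopes in $\mathbb R^n$ such that $P_i\subseteq Q_i$ for every $i\in\{1,\dots,n\}$. For $u\in\mathbb S^{n-1}$ let $$T_u=\{i\in\{1,\dots,n\}\ |\ P_i\cap Q_i^u\neq\emptyset\}.$$ Then $V(P_1,\dots,P_n)<V(Q_1,\dots,Q_n)$ if and only if there exists $u\in\mathbb S^{n-1}$ such that the collection $\{Q_i^u\ |\ i\in T_u\}\cup\{Q_i\ |\ i\in\{1,\dots,n\}\setminus T_u\}$ is essential.
   Context: $V(K_1,\dots,K_n)$ denotes the mixed volume of convex bodies in $\mathbb R^n$ (the coefficient of $\lambda_1\cdots\lambda_n$ in the polynomial $\operatorname{Vol}_n(\lambda_1K_1+\dots+\lambda_nK_n)$, $\lambda_i\ge0$). For a convex body $K$ and $u\in\mathbb R^n$, $h_K(u)=\max\{\langle u,x\rangle\mid x\in K\}$ is the support function and $K^u=\{x\in K\mid \langle u,x\rangle=h_K(u)\}$ is the face of $K$ with outer normal $u$. A collection (multiset) $\{K_1,\dots,K_m\}$ of convex bodies in $\mathbb R^n$ is essential if for every subset $I\subseteq\{1,\dots,m\}$ with $|I|\le n$ one has $\dim\sum_{i\in I}K_i\ge |I|$ (Minkowski sum). *)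

theory Defs
  imports "HOL-Analysis.Analysis"
begin

definition mindex :: "nat \<Rightarrow> (nat \<Rightarrow> nat) set" where
  "mindex n = {\<alpha>. \<forall>i. (i < n \<longrightarrow> \<alpha> i \<le> n) \<and> (n \<le> i \<longrightarrow> \<alpha> i = 0)}"

definition mixed_volume :: "(nat \<Rightarrow> 'a::euclidean_space set) \<Rightarrow> real" where
  "mixed_volume K = (THE c. \<exists>a :: (nat \<Rightarrow> nat) \<Rightarrow> real.
     (\<forall>l :: nat \<Rightarrow> real. (\<forall>i. 0 \<le> l i) \<longrightarrow>
        measure lebesgue (\<Sum>i<DIM('a). (\<lambda>x. l i *\<^sub>R x) ` K i)
        = (\<Sum>\<alpha>\<in>mindex DIM('a). a \<alpha> * (\<Prod>i<DIM('a). l i ^ \<alpha> i)))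
     \<and> c = a (\<lambda>i. if i < DIM('a) then 1 else 0))"

definition support_fn :: "'a::euclidean_space set \<Rightarrow> 'a \<Rightarrow> real" where
  "support_fn K u = Sup ((\<lambda>x. inner u x) ` K)"

definition face_dir :: "'a::euclidean_space set \<Rightarrow> 'a \<Rightarrow> 'a set" where
  "face_dir K u = {x \<in> K. inner u x = support_fn K u}"

definition essential :: "nat set \<Rightarrow> (nat \<Rightarrow> 'a::euclidean_space set) \<Rightarrow> bool" where
  "essential J K \<longleftrightarrow> (\<forall>I \<subseteq> J. card I \<le> DIM('a) \<longrightarrow> aff_dim (\<Sum>i\<in>I. K i) \<ge> int (card I))"

end

theory Submission
  imports Defs
begin

text \<open>
  Write each polytope as the convex hull of a finite set \<open>A i\<close>, give the points weights \<open>w i\<close>, and let the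
  cell of a slope \<open>y\<close> consist of the points of \<open>A i\<close> maximising \<open>y \<bullet> a - w i a\<close>. Up to null sets the
  Minkowski sum \<open>\<Sum>i. l i * conv (A i)\<close> is the disjoint union, over finitely many slopes independent of
  \<open>l\<close>, of the Minkowski sums of the cells. Subdividing until the cells are simplices in general position
  shows that the volume is a polynomial in \<open>l\<close> with nonnegative coefficients, and that a positive mixed
  volume forces the bodies to contain segments with linearly independent directions. By Rado's theorem
  the latter is the same as being essential.

  Moreover, the mixed volume is the sum of the mixed volumes of the cells, for every choice of weights.
  With weight 0 on the vertices of \<open>P i\<close> and 1 on the other vertices of \<open>Q i\<close>, the cell of slope 0 is \<open>P i\<close>,
  so \<open>V(P) < V(Q)\<close> yields a slope \<open>y \<noteq> 0\<close> with cells of positive mixed volume, and \<open>u = y / norm y\<close> works.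
  Conversely, for a given \<open>u\<close> cut \<open>Q i\<close> at a level \<open>c i\<close> of \<open>u\<close>, above \<open>P i\<close> and at or below the maximum on \<open>Q i\<close>, and
  use the weights \<open>max 0 (u \<bullet> a - c i)\<close>: the cell of slope 0 contains \<open>P i\<close> and the cell of slope \<open>u\<close> is the
  upper part of \<open>Q i\<close>, so that \<open>V(Q)\<close> is at least \<open>V(P)\<close> plus the positive mixed volume of the upper parts.
\<close>

section \<open>Lebesgue measure of linear images\<close>

text \<open>Uniqueness of Haar measure: integrate the indicator of \<open>x\<close> in
  \<open>A\<close> and \<open>y - x\<close> in \<open>B\<close> against \<open>lborel\<close> and
  \<open>M\<close>. Invariance of \<open>M\<close> evaluates the integral over \<open>y\<close> as
  \<open>emeasure M B\<close>, while the substitution of \<open>y - x\<close> for \<open>x\<close>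
  exchanges the roles of \<open>A\<close> and \<open>B\<close>.\<close>

lemma translation_invariant_measure_unique:
  fixes M :: "'a::euclidean_space measure"
  assumes sets_M: "sets M = sets borel" and "sigma_finite_measure M"
    and inv: "\<And>t A. A \<in> sets borel \<Longrightarrow> emeasure M ((+) t ` A) = emeasure M A"
    and A: "A \<in> sets borel" and B: "B \<in> sets borel"
  shows "emeasure lborel A * emeasure M B = emeasure lborel B * emeasure M A"
proof -
  interpret sigma_finite_measure M by fact
  interpret pair_sigma_finite lborel M ..
  note [measurable] = A B
  note [measurable_cong] = sets_M
  have trans: "emeasure M {y. y - x \<in> C} = emeasure M C" if "C \<in> sets borel" for x C
  proof -
    have "{y. y - x \<in> C} = (+) x ` C"
      by (force simp: image_iff algebra_simps)
    then show ?thesis using inv[OF that] by simp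
  qed
  have refl: "(\<integral>\<^sup>+x. f (y - x) \<partial>lborel) = (\<integral>\<^sup>+x. f x \<partial>lborel)"
    if [measurable]: "f \<in> borel_measurable borel" for f :: "'a \<Rightarrow> ennreal" and y
  proof -
    have eq: "lborel = density (distr lborel borel (\<lambda>x. y + (- 1) *\<^sub>R x)) (\<lambda>_. \<bar>(- 1)::real\<bar> ^ DIM('a))"
      by (rule lborel_affine) simp
    show ?thesis
      by (subst (2) eq) (simp add: nn_integral_density nn_integral_distr)
  qed
  have "emeasure lborel A * emeasure M B = (\<integral>\<^sup>+x. indicator A x * emeasure M B \<partial>lborel)"
    by (simp add: nn_integral_multc)
  also have "\<dots> = (\<integral>\<^sup>+x. (\<integral>\<^sup>+y. indicator A x * indicator B (y - x) \<partial>M) \<partial>lborel)"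
  proof (rule nn_integral_cong)
    fix x
    have "(\<integral>\<^sup>+y. indicator B (y - x) \<partial>M) = (\<integral>\<^sup>+y. indicator {y. y - x \<in> B} y \<partial>M)"
      by (simp add: indicator_def)
    also have "\<dots> = emeasure M {y. y - x \<in> B}"
      by (subst nn_integral_indicator) (simp_all add: sets_M)
    finally show "indicator A x * emeasure M B = (\<integral>\<^sup>+y. indicator A x * indicator B (y - x) \<partial>M)"
      by (simp add: nn_integral_cmult trans[OF B])
  qed
  also have "\<dots> = (\<integral>\<^sup>+y. (\<integral>\<^sup>+x. indicator A x * indicator B (y - x) \<partial>lborel) \<partial>M)"
    by (rule Fubini'[symmetric]) simp
  also have "\<dots> = (\<integral>\<^sup>+y. (\<integral>\<^sup>+x. indicator A (y - x) * indicator B x \<partial>lborel) \<partial>M)"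
  proof (rule nn_integral_cong)
    fix y
    show "(\<integral>\<^sup>+x. indicator A x * indicator B (y - x) \<partial>lborel) =
        (\<integral>\<^sup>+x. indicator A (y - x) * indicator B x \<partial>lborel)"
      using refl[of "\<lambda>x. indicator A x * indicator B (y - x)" y] by simp
  qed
  also have "\<dots> = (\<integral>\<^sup>+x. (\<integral>\<^sup>+y. indicator A (y - x) * indicator B x \<partial>M) \<partial>lborel)"
    by (rule Fubini') simp
  also have "\<dots> = (\<integral>\<^sup>+x. emeasure M A * indicator B x \<partial>lborel)"
  proof (rule nn_integral_cong)
    fix x
    have "(\<integral>\<^sup>+y. indicator A (y - x) \<partial>M) = (\<integral>\<^sup>+y. indicator {y. y - x \<in> A} y \<partial>M)"
      by (simp add: indicator_def)
    also have "\<dots> = emeasure M {y. y - x \<in> A}"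
      by (subst nn_integral_indicator) (simp_all add: sets_M)
    finally show "(\<integral>\<^sup>+y. indicator A (y - x) * indicator B x \<partial>M) = emeasure M A * indicator B x"
      by (simp add: nn_integral_multc trans[OF A])
  qed
  also have "\<dots> = emeasure M A * emeasure lborel B"
    by (simp add: nn_integral_cmult)
  finally show ?thesis by (simp only: mult.commute)
qed

text \<open>The volume of the image under \<open>g\<close> is a translation-invariant measure,
  namely the pushforward of \<open>lborel\<close> by the inverse \<open>h\<close>, hence a multiple
  of Lebesgue measure. The factor is its value on the unit cube, which stands for the absolute value
  of the determinant.\<close>

lemma linear_bij_image_measure:
  fixes g :: "'a::euclidean_space \<Rightarrow> 'a"
  assumes lin: "linear g" and bij: "bij g"
  obtains k where "\<And>A. compact A \<Longrightarrow> measure lebesgue (g ` A) = k * measure lebesgue A"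
proof -
  obtain h where h: "linear h" "\<And>x. h (g x) = x" "\<And>x. g (h x) = x"
    using linear_injective_isomorphism[OF lin bij_is_inj[OF bij]] by metis
  have [measurable]: "h \<in> borel_measurable borel"
    by (intro borel_measurable_continuous_onI linear_continuous_on linear_conv_bounded_linear[THEN iffD1, OF h(1)]) 
  have vim: "h -` A = g ` A" for A
    using h(2,3) by (auto simp: image_iff) (metis h(3))
  define M where "M = distr lborel borel h"
  have em: "emeasure M A = emeasure lborel (g ` A)" if "A \<in> sets borel" for A
    using that by (simp add: M_def emeasure_distr vim)
  have cpt: "emeasure M A < \<infinity>" if "compact A" for A
  proof -
    have "compact (g ` A)"
      using that lin by (intro compact_continuous_image linear_continuous_on linear_conv_bounded_linear[THEN iffD1, OF lin])
    then show ?thesis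
      using emeasure_bounded_finite[OF compact_imp_bounded] em[of A] that by (auto simp: borel_compact)
  qed
  have sf: "sigma_finite_measure M"
  proof
    show "\<exists>A. countable A \<and> A \<subseteq> sets M \<and> \<Union>A = space M \<and> (\<forall>a\<in>A. emeasure M a \<noteq> \<infinity>)"
    proof (intro exI[of _ "range (\<lambda>n::nat. cball 0 (real n))"] conjI ballI)
      show "\<Union>(range (\<lambda>n::nat. cball (0::'a) (real n))) = space M"
        by (auto simp: M_def real_arch_simple)
      fix a assume "a \<in> range (\<lambda>n::nat. cball (0::'a) (real n))"
      then show "emeasure M a \<noteq> \<infinity>" using cpt by (auto simp: less_top)
    qed (auto simp: M_def)
  qed
  have transl: "(+) t ` A \<in> sets borel" if "A \<in> sets borel" for t :: 'a and A
  proof -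
    have "(+) t ` A = (\<lambda>x. x - t) -` A \<inter> space borel" by (force simp: image_iff algebra_simps)
    also have "\<dots> \<in> sets borel" using that by (intro measurable_sets[of _ borel borel]) auto
    finally show ?thesis .
  qed
  have inv: "emeasure M ((+) t ` A) = emeasure M A" if A: "A \<in> sets borel" for t A
  proof -
    have gA: "g ` A \<in> sets borel"
      using A measurable_sets[of h borel borel A] by (simp add: vim)
    have "g ` ((+) t ` A) = (+) (g t) ` (g ` A)"
      by (auto simp: image_image linear_add[OF lin])
    then have "emeasure M ((+) t ` A) = emeasure lebesgue ((+) (g t) ` (g ` A))"
      using em[OF transl[OF A]] transl[OF gA] by simp
    also have "\<dots> = emeasure lebesgue (g ` A)"
      using emeasure_lebesgue_affine[of 1 "g t" "g ` A"] by (simp add: add.commute)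
    finally show ?thesis using em[OF A] gA by simp
  qed
  let ?B = "cbox 0 (One::'a)"
  have Bf: "emeasure lborel ?B = 1" by (simp add: emeasure_lborel_cbox_eq inner_diff_left)
  have "measure lebesgue (g ` A) = measure M ?B * measure lebesgue A" if "compact A" for A
  proof -
    have "emeasure lborel A * emeasure M ?B = emeasure lborel ?B * emeasure M A"
      using that by (intro translation_invariant_measure_unique sf inv) (auto simp: M_def borel_compact)
    then have "emeasure lborel (g ` A) = emeasure lborel A * emeasure M ?B"
      using Bf em[of A] that by (simp add: borel_compact)
    then have "measure lborel (g ` A) = measure lborel A * measure M ?B"
      by (simp add: measure_def enn2real_mult)
    moreover have "compact (g ` A)"
      using that lin by (intro compact_continuous_image linear_continuous_on linear_conv_bounded_linear[THEN iffD1, OF lin])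
    ultimately show ?thesis using that 
      by (simp add: measure_completion borel_compact)
  qed
  then show ?thesis by (rule that)
qed

section \<open>Regular mixed subdivisions\<close>

definition msum :: "(nat \<Rightarrow> real) \<Rightarrow> (nat \<Rightarrow> 'a::euclidean_space set) \<Rightarrow> 'a set" where
  "msum l K = (\<Sum>i<DIM('a). (\<lambda>x. l i *\<^sub>R x) ` K i)"

text \<open>For nonempty \<open>K i\<close>, the span of this set is the linear space parallel to
  the affine hull of the Minkowski sum over \<open>I\<close>.\<close>

definition differences :: "nat set \<Rightarrow> (nat \<Rightarrow> 'a::euclidean_space set) \<Rightarrow> 'a set" where
  "differences I K = (\<Union>i\<in>I. (\<lambda>(a, b). a - b) ` (K i \<times> K i))"

text \<open>Lift each \<open>a\<close> to height \<open>w a\<close>; these are the points of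
  \<open>A\<close> whose lifts lie on the lower supporting hyperplane of slope
  \<open>y\<close>.\<close>

definition cell :: "('a \<Rightarrow> real) \<Rightarrow> 'a::euclidean_space set \<Rightarrow> 'a \<Rightarrow> 'a set" where
  "cell w A y = {a \<in> A. \<forall>b\<in>A. y \<bullet> b - w b \<le> y \<bullet> a - w a}"

text \<open>The Legendre-Fenchel conjugate of \<open>w\<close> on \<open>A\<close>, convex and
  piecewise linear in \<open>y\<close> for finite nonempty \<open>A\<close>; its subgradients at
  \<open>y\<close> are the points of the hull of the cell.\<close>

definition conjugate :: "('a \<Rightarrow> real) \<Rightarrow> 'a::euclidean_space set \<Rightarrow> 'a \<Rightarrow> real" where
  "conjugate w A y = Max ((\<lambda>a. y \<bullet> a - w a) ` A)"

text \<open>The slopes whose cells have a full-dimensional Minkowski sum; at all other slopes the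
  sum of the cells carries no volume.\<close>

definition breakpoints ::
    "(nat \<Rightarrow> 'a \<Rightarrow> real) \<Rightarrow> (nat \<Rightarrow> 'a::euclidean_space set) \<Rightarrow> 'a set" where
  "breakpoints w A = {y. span (differences {..<DIM('a)} (\<lambda>i. cell (w i) (A i) y)) = UNIV}"

section \<open>Minkowski combinations: membership, compactness and degenerate sums\<close>

lemma mem_msum:
  fixes K :: "nat \<Rightarrow> 'a::euclidean_space set"
  shows "x \<in> msum l K \<longleftrightarrow>
    (\<exists>p. (\<forall>i<DIM('a). p i \<in> K i) \<and> x = (\<Sum>i<DIM('a). l i *\<^sub>R p i))"
proof
  assume "x \<in> msum l K"
  then obtain s where s: "x = sum s {..<DIM('a)}" "\<forall>i<DIM('a). s i \<in> (\<lambda>x. l i *\<^sub>R x) ` K i"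
    unfolding msum_def set_sum_alt[OF finite_lessThan] by auto
  then have "\<forall>i. \<exists>q. i < DIM('a) \<longrightarrow> q \<in> K i \<and> s i = l i *\<^sub>R q" by auto
  then obtain p where "\<forall>i<DIM('a). p i \<in> K i \<and> s i = l i *\<^sub>R p i" by metis
  with s(1) show "\<exists>p. (\<forall>i<DIM('a). p i \<in> K i) \<and> x = (\<Sum>i<DIM('a). l i *\<^sub>R p i)"
    by (intro exI[of _ p]) auto
next
  assume "\<exists>p. (\<forall>i<DIM('a). p i \<in> K i) \<and> x = (\<Sum>i<DIM('a). l i *\<^sub>R p i)"
  then show "x \<in> msum l K"
    unfolding msum_def set_sum_alt[OF finite_lessThan] by auto
qed

lemma msum_cong:
  fixes K L :: "nat \<Rightarrow> 'a::euclidean_space set"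
  assumes "\<And>i. i < DIM('a) \<Longrightarrow> K i = L i"
  shows "msum l K = msum l L"
  using assms by (simp add: msum_def)

lemma msum_mono:
  fixes K L :: "nat \<Rightarrow> 'a::euclidean_space set"
  assumes "\<And>i. i < DIM('a) \<Longrightarrow> K i \<subseteq> L i"
  shows "msum l K \<subseteq> msum l L"
proof
  fix x assume "x \<in> msum l K"
  then obtain p where "\<forall>i<DIM('a). p i \<in> K i" "x = (\<Sum>i<DIM('a). l i *\<^sub>R p i)"
    unfolding mem_msum by blast
  with assms show "x \<in> msum l L"
    unfolding mem_msum by (intro exI[of _ p]) auto
qed

lemma convex_msum:
  fixes K :: "nat \<Rightarrow> 'a::euclidean_space set"
  assumes "\<And>i. i < DIM('a) \<Longrightarrow> convex (K i)"
  shows "convex (msum l K)"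
  unfolding msum_def using assms by (intro convex_set_sum convex_scaling) simp

lemma compact_set_sum:
  fixes B :: "'i \<Rightarrow> 'a::euclidean_space set"
  assumes "finite I" "\<And>i. i \<in> I \<Longrightarrow> compact (B i)"
  shows "compact (\<Sum>i\<in>I. B i)"
  using assms
proof (induction rule: finite_induct)
  case (insert i I)
  then have "compact {x + y |x y. x \<in> B i \<and> y \<in> (\<Sum>i\<in>I. B i)}"
    by (intro compact_sums) auto
  moreover have "{x + y |x y. x \<in> B i \<and> y \<in> (\<Sum>i\<in>I. B i)} = B i + (\<Sum>i\<in>I. B i)"
    by (auto simp: set_plus_def)
  ultimately show ?case using insert by simp
qed (simp add: set_zero)

lemma compact_msum:
  fixes K :: "nat \<Rightarrow> 'a::euclidean_space set"
  assumes "\<And>i. i < DIM('a) \<Longrightarrow> compact (K i)"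
  shows "compact (msum l K)"
  unfolding msum_def using assms by (intro compact_set_sum compact_scaling) simp_all

lemma differences_cong: "(\<And>i. i \<in> I \<Longrightarrow> K i = L i) \<Longrightarrow> differences I K = differences I L"
  by (simp add: differences_def)

lemma differences_mono: "(\<And>i. i \<in> I \<Longrightarrow> K i \<subseteq> L i) \<Longrightarrow> differences I K \<subseteq> differences I L"
  unfolding differences_def by (intro UN_mono image_mono Sigma_mono) auto

text \<open>The functional \<open>d\<close> is constant on every scaled summand, hence on the whole
  sum, which therefore lies in a hyperplane. If some \<open>A i\<close> is empty, so is the
  sum.\<close>

lemma negligible_msum_hyperplane:
  fixes A :: "nat \<Rightarrow> 'a::euclidean_space set"
  assumes "d \<noteq> 0" and "\<And>i a b. \<lbrakk>i < DIM('a); a \<in> A i; b \<in> A i\<rbrakk> \<Longrightarrow> l i * (d \<bullet> (a - b)) = 0"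
  shows "negligible (msum l (\<lambda>i. convex hull (A i)))"
proof (cases "\<exists>i<DIM('a). A i = {}")
  case True
  then have "x \<notin> msum l (\<lambda>i. convex hull (A i))" for x
    unfolding mem_msum by (metis convex_hull_empty empty_iff)
  then have "msum l (\<lambda>i. convex hull (A i)) = {}" by blast
  then show ?thesis by simp
next
  case False
  then have "\<forall>i. \<exists>q. i < DIM('a) \<longrightarrow> q \<in> A i" by blast
  then obtain p where p: "\<And>i. i < DIM('a) \<Longrightarrow> p i \<in> A i" by metis
  have hull: "convex hull (A i) \<subseteq> {x. (l i *\<^sub>R d) \<bullet> x = l i * (d \<bullet> p i)}" if "i < DIM('a)" for i
    using assms(2)[OF that _ p[OF that]] 
    by (intro hull_minimal convex_hyperplane) (auto simp: inner_diff_right algebra_simps)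
  have "msum l (\<lambda>i. convex hull (A i)) \<subseteq> {x. d \<bullet> x = (\<Sum>i<DIM('a). l i * (d \<bullet> p i))}"
  proof
    fix x assume "x \<in> msum l (\<lambda>i. convex hull (A i))"
    then obtain q where "\<forall>i<DIM('a). q i \<in> convex hull (A i)" "x = (\<Sum>i<DIM('a). l i *\<^sub>R q i)"
      by (auto simp: mem_msum)
    moreover have "l i * (d \<bullet> q i) = l i * (d \<bullet> p i)" if "i < DIM('a)" for i
      using hull[OF that] calculation(1) that by auto
    then have "(\<Sum>i<DIM('a). l i * (d \<bullet> q i)) = (\<Sum>i<DIM('a). l i * (d \<bullet> p i))"
      by (intro sum.cong) auto
    ultimately show "x \<in> {x. d \<bullet> x = (\<Sum>i<DIM('a). l i * (d \<bullet> p i))}"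
      by (simp add: inner_sum_right)
  qed
  moreover have "negligible {x. d \<bullet> x = (\<Sum>i<DIM('a). l i * (d \<bullet> p i))}"
    using assms(1) by (intro negligible_hyperplane) auto
  ultimately show ?thesis by (rule negligible_subset[rotated])
qed

lemma negligible_msum:
  fixes A :: "nat \<Rightarrow> 'a::euclidean_space set"
  assumes "span (differences {..<DIM('a)} A) \<noteq> UNIV"
  shows "negligible (msum l (\<lambda>i. convex hull (A i)))"
proof -
  obtain d where d: "d \<noteq> 0" "span (differences {..<DIM('a)} A) \<subseteq> {x. d \<bullet> x = 0}"
    using span_not_univ_subset_hyperplane[OF assms] by auto
  have "d \<bullet> (a - b) = 0" if "i < DIM('a)" "a \<in> A i" "b \<in> A i" for i a b
    using that d(2) span_base[of "a - b" "differences {..<DIM('a)} A"] by (auto simp: differences_def)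
  then show ?thesis using d(1) by (intro negligible_msum_hyperplane) auto
qed

section \<open>Cells of a weight function and its conjugate\<close>

lemma cell_subset: "cell w A y \<subseteq> A"
  by (auto simp: cell_def)

lemma mem_cell_iff:
  assumes "finite A"
  shows "a \<in> cell w A y \<longleftrightarrow> a \<in> A \<and> y \<bullet> a - w a = conjugate w A y"
proof
  assume "a \<in> cell w A y"
  then show "a \<in> A \<and> y \<bullet> a - w a = conjugate w A y"
    using assms unfolding cell_def conjugate_def by (auto intro!: Max_eqI[symmetric])
next
  assume "a \<in> A \<and> y \<bullet> a - w a = conjugate w A y"
  then show "a \<in> cell w A y"
    using assms unfolding cell_def conjugate_def by auto
qed

lemma conjugate_ge: "finite A \<Longrightarrow> a \<in> A \<Longrightarrow> y \<bullet> a - w a \<le> conjugate w A y"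
  unfolding conjugate_def by (auto intro!: Max_ge)

lemma cell_nonempty:
  assumes "finite A" "A \<noteq> {}"
  shows "cell w A y \<noteq> {}"
proof -
  have "Max ((\<lambda>a. y \<bullet> a - w a) ` A) \<in> (\<lambda>a. y \<bullet> a - w a) ` A"
    using assms by (intro Max_in) auto
  then obtain a where "a \<in> A" "conjugate w A y = y \<bullet> a - w a"
    by (auto simp: conjugate_def)
  then show ?thesis using mem_cell_iff[OF assms(1), of a w y] by auto
qed

lemma continuous_on_conjugate:
  assumes "finite A" "A \<noteq> {}"
  shows "continuous_on S (conjugate w A)"
proof -
  have "continuous_on S (\<lambda>y. Max ((\<lambda>a. y \<bullet> a - w a) ` A))"
    using assms
  proof (induction rule: finite_ne_induct)
    case (insert a A)
    then have "continuous_on S (\<lambda>y. max (y \<bullet> a - w a) (Max ((\<lambda>a. y \<bullet> a - w a) ` A)))"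
      by (intro continuous_on_max continuous_intros)
    with insert show ?case by simp
  qed (auto intro!: continuous_intros)
  then show ?thesis by (simp add: conjugate_def[abs_def])
qed

text \<open>Points of the cell attain the maximum at \<open>y\<close> and compete for the maximum at
  \<open>z\<close>. The resulting condition on \<open>p\<close> is a half-space, so it passes to the
  hull.\<close>

lemma conjugate_subgradient:
  assumes "finite A" and p: "p \<in> convex hull (cell w A y)"
  shows "(z - y) \<bullet> p \<le> conjugate w A z - conjugate w A y"
proof -
  have "cell w A y \<subseteq> {p. (z - y) \<bullet> p \<le> conjugate w A z - conjugate w A y}"
    using assms(1) conjugate_ge[of A _ z w] by (fastforce simp: mem_cell_iff inner_diff_left)
  then have "convex hull (cell w A y) \<subseteq> {p. (z - y) \<bullet> p \<le> conjugate w A z - conjugate w A y}"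
    by (intro hull_minimal convex_halfspace_le)
  with p show ?thesis by auto
qed

lemma msum_cells_subgradient:
  fixes A :: "nat \<Rightarrow> 'a::euclidean_space set"
  assumes fin: "\<And>i. i < DIM('a) \<Longrightarrow> finite (A i)" and l: "\<And>i. 0 \<le> l i"
    and x: "x \<in> msum l (\<lambda>i. convex hull (cell (w i) (A i) y))"
  shows "(z - y) \<bullet> x \<le> (\<Sum>i<DIM('a). l i * conjugate (w i) (A i) z) - (\<Sum>i<DIM('a). l i * conjugate (w i) (A i) y)"
proof -
  obtain p where p: "\<forall>i<DIM('a). p i \<in> convex hull (cell (w i) (A i) y)"
      "x = (\<Sum>i<DIM('a). l i *\<^sub>R p i)"
    using x by (auto simp: mem_msum)
  have "(z - y) \<bullet> x = (\<Sum>i<DIM('a). l i * ((z - y) \<bullet> p i))"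
    by (simp add: p inner_sum_right)
  also have "\<dots> \<le> (\<Sum>i<DIM('a). l i * (conjugate (w i) (A i) z - conjugate (w i) (A i) y))"
    using p l fin by (intro sum_mono mult_left_mono conjugate_subgradient) auto
  finally show ?thesis by (simp add: algebra_simps sum_subtractf)
qed

text \<open>A common point is a subgradient of the same convex function at \<open>y\<close> and at
  \<open>z\<close>. The two subgradient inequalities combine to an equation, which describes a
  hyperplane because \<open>y \<noteq> z\<close>.\<close>

lemma negligible_Int_msum_cells:
  fixes A :: "nat \<Rightarrow> 'a::euclidean_space set"
  assumes fin: "\<And>i. i < DIM('a) \<Longrightarrow> finite (A i)" and l: "\<And>i. 0 \<le> l i" and "y \<noteq> z"
  shows "negligible (msum l (\<lambda>i. convex hull (cell (w i) (A i) y)) \<inter>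
                     msum l (\<lambda>i. convex hull (cell (w i) (A i) z)))"
proof -
  define F where "F y = (\<Sum>i<DIM('a). l i * conjugate (w i) (A i) y)" for y
  have "msum l (\<lambda>i. convex hull (cell (w i) (A i) y)) \<inter> msum l (\<lambda>i. convex hull (cell (w i) (A i) z))
      \<subseteq> {x. (z - y) \<bullet> x = F z - F y}"
  proof
    fix x assume x: "x \<in> msum l (\<lambda>i. convex hull (cell (w i) (A i) y)) \<inter> msum l (\<lambda>i. convex hull (cell (w i) (A i) z))"
    have "(z - y) \<bullet> x \<le> F z - F y" "(y - z) \<bullet> x \<le> F y - F z"
      unfolding F_def using x msum_cells_subgradient[where A=A and l=l and w=w and x=x, OF fin l] by auto
    then show "x \<in> {x. (z - y) \<bullet> x = F z - F y}"
      by (simp add: inner_diff_left)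
  qed
  moreover have "negligible {x. (z - y) \<bullet> x = F z - F y}"
    using \<open>y \<noteq> z\<close> by (intro negligible_hyperplane) auto
  ultimately show ?thesis by (rule negligible_subset[rotated])
qed

text \<open>A maximiser at \<open>y\<close> beats the finitely many points outside the cell by
  strict inequalities, and these survive a small change of slope.\<close>

lemma cell_perturb:
  assumes fin: "finite A" "A \<noteq> {}"
  shows "eventually (\<lambda>t. cell w A (y - t *\<^sub>R d) \<subseteq> cell w A y) (at_right 0)"
proof -
  obtain a where a: "a \<in> cell w A y" using cell_nonempty[OF fin] by blast
  have "eventually (\<lambda>t. 0 < ((y - t *\<^sub>R d) \<bullet> a - w a) - ((y - t *\<^sub>R d) \<bullet> b - w b)) (at_right 0)"
    if b: "b \<in> A - cell w A y" for b
  proof (rule order_tendstoD(1))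
    show "((\<lambda>t. ((y - t *\<^sub>R d) \<bullet> a - w a) - ((y - t *\<^sub>R d) \<bullet> b - w b)) \<longlongrightarrow>
        ((y - 0 *\<^sub>R d) \<bullet> a - w a) - ((y - 0 *\<^sub>R d) \<bullet> b - w b)) (at_right 0)"
      by (intro tendsto_intros)
    have "y \<bullet> b - w b \<noteq> conjugate w A y" "y \<bullet> b - w b \<le> conjugate w A y"
      using b conjugate_ge[of A b y w] fin by (auto simp: mem_cell_iff)
    then show "0 < ((y - 0 *\<^sub>R d) \<bullet> a - w a) - ((y - 0 *\<^sub>R d) \<bullet> b - w b)"
      using a fin by (auto simp: mem_cell_iff)
  qed
  then have "eventually (\<lambda>t. \<forall>b\<in>A - cell w A y. 0 < ((y - t *\<^sub>R d) \<bullet> a - w a) - ((y - t *\<^sub>R d) \<bullet> b - w b)) (at_right 0)"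
    using fin by (intro eventually_ball_finite) auto
  then show ?thesis
  proof eventually_elim
    case (elim t)
    show ?case
    proof
      fix b assume b: "b \<in> cell w A (y - t *\<^sub>R d)"
      show "b \<in> cell w A y"
      proof (rule ccontr)
        assume "b \<notin> cell w A y"
        then have "0 < ((y - t *\<^sub>R d) \<bullet> a - w a) - ((y - t *\<^sub>R d) \<bullet> b - w b)"
          using elim b cell_subset by blast
        moreover have "(y - t *\<^sub>R d) \<bullet> a - w a \<le> (y - t *\<^sub>R d) \<bullet> b - w b"
          using a b by (auto simp: cell_def)
        ultimately show False by simp
      qed
    qed
  qed
qed

text \<open>The slope of the cell over \<open>x\<close> is a minimiser of \<open>z \<mapsto> F z - z \<bullet> x\<close>, where \<open>F\<close> is the
  conjugate of the lifted polytopes; it exists because this function is coercive for interior \<open>x\<close>.\<close>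

lemma interior_msum_covered:
  fixes A :: "nat \<Rightarrow> 'a::euclidean_space set"
  assumes fin: "\<And>i. i < DIM('a) \<Longrightarrow> finite (A i) \<and> A i \<noteq> {}" and l: "\<And>i. 0 \<le> l i"
    and x: "x \<in> interior (msum l (\<lambda>i. convex hull (A i)))"
  obtains y where "x \<in> msum l (\<lambda>i. convex hull (cell (w i) (A i) y))"
proof -
  define S where "S = msum l (\<lambda>i. convex hull (A i))"
  define F where "F y = (\<Sum>i<DIM('a). l i * conjugate (w i) (A i) y)" for y
  define G where "G z = F z - z \<bullet> x" for z
  obtain r where r: "r > 0" "cball x r \<subseteq> S"
    using x unfolding S_def[symmetric] by (auto simp: mem_interior_cball)
  \<comment> \<open>A common upper bound \<open>W\<close> of the weights makes \<open>F z\<close>,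
    up to the constant \<open>C\<close>, an upper bound for the functional \<open>z\<close> on all
    of \<open>S\<close>.\<close>
  have "finite (\<Union>i<DIM('a). w i ` A i)" using fin by auto
  then obtain W where "\<forall>v\<in>(\<Union>i<DIM('a). w i ` A i). v \<le> W"
    using bdd_above_finite unfolding bdd_above_def by blast
  then have W: "\<And>i a. i < DIM('a) \<Longrightarrow> a \<in> A i \<Longrightarrow> w i a \<le> W" by auto
  define C where "C = (\<Sum>i<DIM('a). l i * W)"
  have lower: "z \<bullet> s \<le> F z + C" if s: "s \<in> S" for z s
  proof -
    obtain p where p: "\<forall>i<DIM('a). p i \<in> convex hull (A i)" "s = (\<Sum>i<DIM('a). l i *\<^sub>R p i)"
      using s by (auto simp: S_def mem_msum)
    have "z \<bullet> p i \<le> conjugate (w i) (A i) z + W" if i: "i < DIM('a)" for i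
    proof -
      have "A i \<subseteq> {p. z \<bullet> p \<le> conjugate (w i) (A i) z + W}"
        using W[OF i] conjugate_ge[of "A i" _ z "w i"] fin[OF i] by fastforce
      then have "convex hull (A i) \<subseteq> {p. z \<bullet> p \<le> conjugate (w i) (A i) z + W}"
        by (intro hull_minimal convex_halfspace_le)
      then show ?thesis using p i by auto
    qed
    then have "(\<Sum>i<DIM('a). l i * (z \<bullet> p i)) \<le> (\<Sum>i<DIM('a). l i * (conjugate (w i) (A i) z + W))"
      using l by (intro sum_mono mult_left_mono) auto
    then show ?thesis by (simp add: p inner_sum_right F_def C_def algebra_simps sum.distrib)
  qed
  \<comment> \<open>Apply \<open>lower\<close> at the point of the ball around \<open>x\<close> that
    is farthest in direction \<open>z\<close>.\<close>
  have coercive: "r * norm z - C \<le> G z" for z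
  proof (cases "z = 0")
    case True
    have "x \<in> S" using r by auto
    then show ?thesis using lower[of x z] True by (simp add: G_def)
  next
    case False
    have "x + (r / norm z) *\<^sub>R z \<in> S" using r False by (auto simp: dist_norm)
    then have "z \<bullet> x + (r / norm z) * (z \<bullet> z) \<le> F z + C"
      using lower[of "x + (r / norm z) *\<^sub>R z" z] by (simp add: inner_add_right)
    moreover have "(r / norm z) * (z \<bullet> z) = r * norm z"
      using False by (simp add: dot_square_norm power2_eq_square)
    ultimately show ?thesis by (simp add: G_def)
  qed
  \<comment> \<open>Outside the ball of radius \<open>R\<close> coercivity gives values above
    \<open>G 0\<close>, and the ball contains 0, so a minimiser on the ball is a global one.\<close>
  define R where "R = max 0 ((G 0 + C) / r)"
  have contG: "continuous_on UNIV G"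
    unfolding G_def F_def using fin by (intro continuous_intros continuous_on_conjugate) auto
  obtain y where y: "y \<in> cball 0 R" "\<And>z. z \<in> cball 0 R \<Longrightarrow> G y \<le> G z"
    using continuous_attains_inf[of "cball 0 R" G] continuous_on_subset[OF contG] R_def by force
  have ymin: "G y \<le> G z" for z
  proof (cases "norm z \<le> R")
    case False
    then have "(G 0 + C) / r < norm z" by (auto simp: R_def)
    then have "G 0 < r * norm z - C" using r by (simp add: field_simps)
    moreover have "G y \<le> G 0" using y(2)[of 0] by (simp add: R_def)
    ultimately show ?thesis using coercive[of z] by linarith
  qed (use y in auto)
  let ?C = "msum l (\<lambda>i. convex hull (cell (w i) (A i) y))"
  \<comment> \<open>First-order optimality: if \<open>d\<close> separated \<open>x\<close> from the
    sum of the cells, moving the slope from \<open>y\<close> to \<open>y - t *\<^sub>R d\<close>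
    would lower \<open>G\<close>.\<close>
  have "x \<in> ?C"
  proof (rule ccontr)
    assume "x \<notin> ?C"
    moreover have "compact ?C"
      using fin finite_subset[OF cell_subset]
      by (intro compact_msum finite_imp_compact_convex_hull) auto
    ultimately obtain d b where db: "d \<bullet> x < b" "\<And>c. c \<in> ?C \<Longrightarrow> d \<bullet> c > b"
      using separating_hyperplane_closed_point[of ?C x] convex_msum[of "\<lambda>i. convex hull (cell (w i) (A i) y)" l]
      by (auto simp: compact_imp_closed)
    have "eventually (\<lambda>t. \<forall>i\<in>{..<DIM('a)}. cell (w i) (A i) (y - t *\<^sub>R d) \<subseteq> cell (w i) (A i) y) (at_right 0)"
      using fin by (intro eventually_ball_finite cell_perturb ballI) auto
    then have "eventually (\<lambda>t. t > 0 \<and> (\<forall>i\<in>{..<DIM('a)}. cell (w i) (A i) (y - t *\<^sub>R d) \<subseteq> cell (w i) (A i) y)) (at_right 0)"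
      using eventually_at_right_less by (rule eventually_conj[rotated])
    then obtain t :: real where t: "t > 0" "\<And>i. i < DIM('a) \<Longrightarrow> cell (w i) (A i) (y - t *\<^sub>R d) \<subseteq> cell (w i) (A i) y"
      using eventually_happens trivial_limit_at_right_real by force
    have "\<forall>i. \<exists>a. i < DIM('a) \<longrightarrow> a \<in> cell (w i) (A i) (y - t *\<^sub>R d)"
      using cell_nonempty fin by (metis ex_in_conv)
    then obtain a where a: "\<And>i. i < DIM('a) \<Longrightarrow> a i \<in> cell (w i) (A i) (y - t *\<^sub>R d)" by metis
    define c where "c = (\<Sum>i<DIM('a). l i *\<^sub>R a i)"
    have c: "c \<in> ?C" unfolding mem_msum c_def using a t(2) by (blast intro: hull_inc)
    \<comment> \<open>The point \<open>a i\<close> is a maximiser at both slopes, so the conjugate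
      changes by exactly the linear term.\<close>
    have "conjugate (w i) (A i) (y - t *\<^sub>R d) = conjugate (w i) (A i) y - t * (d \<bullet> a i)" if i: "i < DIM('a)" for i
    proof -
      have "a i \<in> cell (w i) (A i) y" using a t(2) i by blast
      then show ?thesis using a[OF i] fin[OF i] by (auto simp: mem_cell_iff inner_diff_left)
    qed
    then have "F (y - t *\<^sub>R d) = F y - t * (d \<bullet> c)"
      by (simp add: F_def c_def inner_sum_right sum_distrib_left sum_subtractf right_diff_distrib
          mult.left_commute)
    then have "G (y - t *\<^sub>R d) = G y - t * (d \<bullet> c - d \<bullet> x)"
      by (simp add: G_def inner_diff_left algebra_simps)
    moreover have "t * (d \<bullet> c - d \<bullet> x) > 0"
      using t(1) db(1) db(2)[OF c] by (intro mult_pos_pos) auto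
    ultimately show False using ymin[of "y - t *\<^sub>R d"] by linarith
  qed
  then show ?thesis by (rule that)
qed

text \<open>There are finitely many families of subsets of the \<open>A i\<close>, and at a
  breakpoint the family determines the slope: if \<open>y\<close> and \<open>z\<close> have the same
  cells, then \<open>y - z\<close> is orthogonal to all differences within them, and these span the
  space.\<close>

lemma finite_breakpoints:
  fixes A :: "nat \<Rightarrow> 'a::euclidean_space set"
  assumes fin: "\<And>i. i < DIM('a) \<Longrightarrow> finite (A i)"
  shows "finite (breakpoints w A)"
proof (rule finite_imageD)
  let ?f = "\<lambda>y. \<lambda>i\<in>{..<DIM('a)}. cell (w i) (A i) y"
  have "?f ` breakpoints w A \<subseteq> (\<Pi>\<^sub>E i\<in>{..<DIM('a)}. Pow (A i))"
    using cell_subset by fastforce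
  then show "finite (?f ` breakpoints w A)"
    by (rule finite_subset) (use fin in \<open>auto intro!: finite_PiE\<close>)
  show "inj_on ?f (breakpoints w A)"
  proof (rule inj_onI)
    fix y z assume y: "y \<in> breakpoints w A" and eq: "?f y = ?f z"
    have eq': "cell (w i) (A i) y = cell (w i) (A i) z" if "i < DIM('a)" for i
      using fun_cong[OF eq, of i] that by auto
    have "differences {..<DIM('a)} (\<lambda>i. cell (w i) (A i) y) \<subseteq> {v. (y - z) \<bullet> v = 0}"
    proof
      fix v assume "v \<in> differences {..<DIM('a)} (\<lambda>i. cell (w i) (A i) y)"
      then obtain i a b where i: "i < DIM('a)" "a \<in> cell (w i) (A i) y" "b \<in> cell (w i) (A i) y" "v = a - b"
        by (auto simp: differences_def)
      then show "v \<in> {v. (y - z) \<bullet> v = 0}"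
        using i(2,3)[unfolded mem_cell_iff[OF fin[OF i(1)]]]
          i(2,3)[unfolded eq'[OF i(1)] mem_cell_iff[OF fin[OF i(1)]]]
        by (simp add: inner_diff_left inner_diff_right)
    qed
    then have "span (differences {..<DIM('a)} (\<lambda>i. cell (w i) (A i) y)) \<subseteq> {v. (y - z) \<bullet> v = 0}"
      by (intro span_minimal subspace_hyperplane)
    with y have "y - z \<in> {v. (y - z) \<bullet> v = 0}" unfolding breakpoints_def by blast
    then show "y = z" by simp
  qed
qed

text \<open>The sums of cells cover the interior, overlap in null sets, and are null away from the
  breakpoints. The frontier is null because the total sum is convex.\<close>

theorem measure_msum_subdivision:
  fixes A :: "nat \<Rightarrow> 'a::euclidean_space set"
  assumes fin: "\<And>i. i < DIM('a) \<Longrightarrow> finite (A i) \<and> A i \<noteq> {}" and l: "\<And>i. 0 \<le> l i"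
  shows "measure lebesgue (msum l (\<lambda>i. convex hull (A i))) =
    (\<Sum>y\<in>breakpoints w A. measure lebesgue (msum l (\<lambda>i. convex hull (cell (w i) (A i) y))))"
proof -
  define S where "S = msum l (\<lambda>i. convex hull (A i))"
  define C where "C y = msum l (\<lambda>i. convex hull (cell (w i) (A i) y))" for y
  \<comment> \<open>Degenerate cells may occur at infinitely many slopes, but they form only
    finitely many families of point sets, so their union stays negligible.\<close>
  define T where "T = {\<tau> \<in> (\<Pi>\<^sub>E i\<in>{..<DIM('a)}. Pow (A i)). span (differences {..<DIM('a)} \<tau>) \<noteq> UNIV}"
  have "finite T"
    unfolding T_def by (rule finite_subset[of _ "\<Pi>\<^sub>E i\<in>{..<DIM('a)}. Pow (A i)"], blast, rule finite_PiE) (simp_all add: fin)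
  then have negT: "negligible (\<Union>\<tau>\<in>T. msum l (\<lambda>i. convex hull (\<tau> i)))"
    by (intro negligible_Union) (auto simp: T_def intro!: negligible_msum)
  have measC: "C y \<in> lmeasurable" for y
    unfolding C_def using fin finite_subset[OF cell_subset]
    by (intro lmeasurable_compact compact_msum finite_imp_compact_convex_hull) auto
  have "S - (\<Union>y\<in>breakpoints w A. C y) \<subseteq> frontier S \<union> (\<Union>\<tau>\<in>T. msum l (\<lambda>i. convex hull (\<tau> i)))"
  proof
    fix x assume x: "x \<in> S - (\<Union>y\<in>breakpoints w A. C y)"
    show "x \<in> frontier S \<union> (\<Union>\<tau>\<in>T. msum l (\<lambda>i. convex hull (\<tau> i)))"
    proof (cases "x \<in> interior S")
      case True
      then have "\<exists>y. x \<in> C y"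
        unfolding S_def C_def
        using interior_msum_covered[where A=A and l=l and w=w and x=x, OF fin l] by blast
      then obtain y where y: "x \<in> C y" ..
      define \<tau> where "\<tau> = (\<lambda>i\<in>{..<DIM('a)}. cell (w i) (A i) y)"
      have "y \<notin> breakpoints w A" using x y by auto
      moreover have "differences {..<DIM('a)} \<tau> = differences {..<DIM('a)} (\<lambda>i. cell (w i) (A i) y)"
        by (intro differences_cong) (auto simp: \<tau>_def)
      ultimately have "\<tau> \<in> T" using cell_subset by (fastforce simp: T_def \<tau>_def breakpoints_def)
      moreover have "C y = msum l (\<lambda>i. convex hull (\<tau> i))"
        unfolding C_def by (intro msum_cong) (auto simp: \<tau>_def)
      ultimately show ?thesis using y by auto
    next
      case False
      then show ?thesis using x closure_subset by (auto simp: frontier_def)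
    qed
  qed
  moreover have "convex S" unfolding S_def by (intro convex_msum) auto
  ultimately have neg: "negligible (S - (\<Union>y\<in>breakpoints w A. C y))"
    using negligible_subset[OF negligible_Un[OF negligible_convex_frontier negT]] by auto
  have sub: "C y \<subseteq> S" for y
    unfolding C_def S_def by (intro msum_mono hull_mono cell_subset)
  have finY: "finite (breakpoints w A)" using fin by (intro finite_breakpoints) auto
  have "measure lebesgue S = measure lebesgue (\<Union>y\<in>breakpoints w A. C y)"
  proof (rule measure_negligible_symdiff)
    show "(\<Union>y\<in>breakpoints w A. C y) \<in> lmeasurable"
      using finY measC by auto
    show "negligible ((\<Union>y\<in>breakpoints w A. C y) - S \<union> (S - (\<Union>y\<in>breakpoints w A. C y)))"
      using neg sub by (metis Diff_eq_empty_iff UN_least Un_empty_left)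
  qed
  also have "\<dots> = (\<Sum>y\<in>breakpoints w A. measure lebesgue (C y))"
    using finY measC
  proof (rule measure_negligible_finite_Union_image)
    show "pairwise (\<lambda>x y. negligible (C x \<inter> C y)) (breakpoints w A)"
      unfolding pairwise_def C_def using fin l by (auto intro!: negligible_Int_msum_cells)
  qed
  finally show ?thesis by (simp add: S_def C_def)
qed

section \<open>Polynomiality of the volume\<close>

lemma sum_Basis_coordinates:
  fixes b :: "'a::euclidean_space" and f :: "'a \<Rightarrow> 'b::real_vector"
  assumes "b \<in> Basis"
  shows "(\<Sum>b'\<in>Basis. (b \<bullet> b') *\<^sub>R f b') = f b"
proof -
  have "(\<Sum>b'\<in>Basis. (b \<bullet> b') *\<^sub>R f b') = (\<Sum>b'\<in>Basis. if b = b' then f b' else 0)"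
    using assms by (intro sum.cong) (auto simp: inner_Basis)
  with assms show ?thesis by simp
qed

text \<open>Zero factors are included because the coefficients of a Minkowski combination may
  vanish; the image then lies in a coordinate hyperplane and both sides are 0.\<close>

lemma measure_stretch_Basis:
  fixes E :: "'a::euclidean_space set"
  assumes E: "compact E"
  shows "measure lebesgue ((\<lambda>x. \<Sum>b\<in>Basis. (c b * (x \<bullet> b)) *\<^sub>R b) ` E) =
    (\<Prod>b\<in>Basis. \<bar>c b\<bar>) * measure lebesgue E"
proof (cases "\<exists>b\<in>Basis. c b = 0")
  case True
  then obtain b where b: "b \<in> Basis" "c b = 0" by auto
  have "(\<lambda>x. \<Sum>b\<in>Basis. (c b * (x \<bullet> b)) *\<^sub>R b) ` E \<subseteq> {x. x \<bullet> b = 0}"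
    using b by (auto simp: inner_sum_left_Basis)
  then have "negligible ((\<lambda>x. \<Sum>b\<in>Basis. (c b * (x \<bullet> b)) *\<^sub>R b) ` E)"
    by (rule negligible_subset[OF negligible_standard_hyperplane[OF b(1)]])
  moreover have "(\<Prod>b\<in>Basis. \<bar>c b\<bar>) = 0" using b by force
  ultimately show ?thesis by (simp add: negligible_imp_measure0)
next
  case False
  define T where "T = (\<lambda>x::'a. \<Sum>b\<in>Basis. (c b * (x \<bullet> b)) *\<^sub>R b)"
  have [measurable]: "T \<in> borel_measurable borel" by (simp add: T_def)
  have inj: "inj T"
  proof (rule injI)
    fix x y assume "T x = T y"
    then have "c b * (x \<bullet> b) = c b * (y \<bullet> b)" if "b \<in> Basis" for b
      using arg_cong[of "T x" "T y" "\<lambda>z. z \<bullet> b"] inner_sum_left_Basis[OF that]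
      unfolding T_def by metis
    then show "x = y" using False by (intro euclidean_eqI[of x y]) auto
  qed
  have cT: "compact (T ` E)"
    unfolding T_def using E by (intro compact_continuous_image continuous_intros)
  have "lborel = density (distr lborel borel T) (\<lambda>_. (\<Prod>b\<in>Basis. \<bar>c b\<bar>))"
    using lborel_affine_euclidean[of c 0] False by (auto simp: T_def)
  then have "emeasure lborel (T ` E) = emeasure (density (distr lborel borel T) (\<lambda>_. (\<Prod>b\<in>Basis. \<bar>c b\<bar>))) (T ` E)"
    by simp
  also have "\<dots> = ennreal (\<Prod>b\<in>Basis. \<bar>c b\<bar>) * emeasure lborel (T -` (T ` E))"
    using cT by (simp add: emeasure_density_const emeasure_distr borel_compact)
  finally have "emeasure lborel (T ` E) = ennreal (\<Prod>b\<in>Basis. \<bar>c b\<bar>) * emeasure lborel E"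
    by (simp add: inj_vimage_image_eq[OF inj])
  then have "measure lborel (T ` E) = (\<Prod>b\<in>Basis. \<bar>c b\<bar>) * measure lborel E"
    by (simp add: measure_def enn2real_mult prod_nonneg)
  then show ?thesis using E cT by (simp add: T_def borel_compact measure_completion)
qed

text \<open>With a base point chosen in each \<open>A i\<close>, the \<open>DIM('a)\<close> edge
  vectors span and hence form a basis. In this basis, passing from coefficients 1 to
  \<open>l\<close> is, up to translation, a diagonal map that scales the
  \<open>card (A i) - 1\<close> coordinates belonging to \<open>A i\<close> by \<open>l i\<close>;
  this produces the monomial.\<close>

lemma measure_msum_simplices:
  fixes A :: "nat \<Rightarrow> 'a::euclidean_space set"
  assumes fin: "\<And>i. i < DIM('a) \<Longrightarrow> finite (A i) \<and> A i \<noteq> {}" and l: "\<And>i. 0 \<le> l i"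
    and span: "span (differences {..<DIM('a)} A) = UNIV"
    and card: "(\<Sum>i<DIM('a). card (A i) - 1) = DIM('a)"
  shows "measure lebesgue (msum l (\<lambda>i. convex hull (A i))) =
    (\<Prod>i<DIM('a). l i ^ (card (A i) - 1)) * measure lebesgue (msum (\<lambda>_. 1) (\<lambda>i. convex hull (A i)))"
proof -
  have "\<forall>i. \<exists>q. i < DIM('a) \<longrightarrow> q \<in> A i" using fin by blast
  then obtain p where p: "\<And>i. i < DIM('a) \<Longrightarrow> p i \<in> A i" by metis
  define X where "X = (SIGMA i:{..<DIM('a)}. A i - {p i})"
  define v where "v = (\<lambda>(i, a). a - p i)"
  have finX: "finite X" unfolding X_def using fin by auto
  have cardX: "card X = DIM('a)"
    unfolding X_def using fin p card by (subst card_SigmaI) auto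
  \<comment> \<open>The labelling assigns one edge vector to each standard coordinate, and
    \<open>g\<close> sends the standard basis to the edge vectors.\<close>
  obtain \<beta> where \<beta>: "bij_betw \<beta> (Basis::'a set) X"
    using finite_same_card_bij[OF finite_Basis finX] cardX by auto
  define g where "g = (\<lambda>x::'a. \<Sum>b\<in>Basis. (x \<bullet> b) *\<^sub>R v (\<beta> b))"
  have lin: "linear g"
    unfolding g_def by (intro linearI) (simp_all add: inner_add_left scaleR_add_left sum.distrib scaleR_sum_right)
  have gb: "g b = v (\<beta> b)" if "b \<in> Basis" for b
    unfolding g_def using that by (rule sum_Basis_coordinates)
  have surj: "surj g"
  proof -
    have sub: "subspace (range g)" using lin by (simp add: linear_subspace_image)
    have v: "v x \<in> range g" if "x \<in> X" for x
      using \<beta> gb that unfolding bij_betw_def by (metis imageE rangeI)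
    have "a - p i \<in> range g" if "i < DIM('a)" "a \<in> A i" for i a
    proof (cases "a = p i")
      case True then show ?thesis using subspace_0[OF sub] by simp
    next
      case False then show ?thesis using v[of "(i, a)"] that by (auto simp: X_def v_def)
    qed
    then have "(a - p i) - (b - p i) \<in> range g" if "i < DIM('a)" "a \<in> A i" "b \<in> A i" for i a b
      using that subspace_diff[OF sub] by blast
    then have "differences {..<DIM('a)} A \<subseteq> range g" by (auto simp: differences_def)
    then show ?thesis using span span_minimal[OF _ sub] by blast
  qed
  then have bij: "bij g" using linear_surjective_imp_injective[OF lin] by (auto simp: bij_def)
  obtain k where k: "\<And>S. compact S \<Longrightarrow> measure lebesgue (g ` S) = k * measure lebesgue S"
    using linear_bij_image_measure[OF lin bij] by metis
  obtain h where h: "linear h" "\<And>x. h (g x) = x" "\<And>x. g (h x) = x"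
    using linear_injective_isomorphism[OF lin bij_is_inj[OF bij]] by metis
  define D where "D l = (\<lambda>x::'a. \<Sum>b\<in>Basis. (l (fst (\<beta> b)) * (x \<bullet> b)) *\<^sub>R b)" for l :: "nat \<Rightarrow> real"
  \<comment> \<open>\<open>E\<close> is the sum with all coefficients 1, translated by the base
    points and written in edge coordinates.\<close>
  define E where "E = (\<lambda>x. h (x - (\<Sum>i<DIM('a). p i))) ` msum (\<lambda>_. 1) (\<lambda>i. convex hull (A i))"
  have linD: "linear (D l)" for l
    unfolding D_def by (intro linearI)
      (simp_all add: inner_add_left scaleR_add_left sum.distrib scaleR_sum_right distrib_left mult.left_commute)
  define M where "M l = g \<circ> D l \<circ> h" for l
  have linM: "linear (M l)" for l
    unfolding M_def by (intro linear_compose lin linD h)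
  \<comment> \<open>On the points of \<open>A i\<close> this is read off from the basis; the
    condition is affine in \<open>q\<close>, so it extends to the hull.\<close>
  have Mq: "M l (q - p i) = l i *\<^sub>R (q - p i)" if i: "i < DIM('a)" and q: "q \<in> convex hull (A i)" for l i q
  proof -
    let ?U = "{q. M l (q - p i) = l i *\<^sub>R (q - p i)}"
    have "a \<in> ?U" if a: "a \<in> A i" for a
    proof (cases "a = p i")
      case True then show ?thesis by (simp add: linear_0[OF linM])
    next
      case False
      then have "(i, a) \<in> X" using a i by (auto simp: X_def)
      then obtain b where b: "b \<in> Basis" "\<beta> b = (i, a)"
        using \<beta> unfolding bij_betw_def by (metis imageE)
      have "D l b = l i *\<^sub>R b"
        using sum_Basis_coordinates[OF b(1), of "\<lambda>b. l (fst (\<beta> b)) *\<^sub>R b"] b(2)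
        by (simp add: D_def mult.commute)
      moreover have "g b = a - p i" using gb b by (simp add: v_def)
      ultimately show ?thesis
        using h(2)[of b] by (simp add: M_def linear_cmul[OF lin])
    qed
    moreover have "convex ?U"
    proof (rule convexI)
      fix x y and u v :: real assume xy: "x \<in> ?U" "y \<in> ?U" and uv: "u + v = 1"
      have "p i = u *\<^sub>R p i + v *\<^sub>R p i" using uv by (simp flip: scaleR_left_distrib)
      then have "u *\<^sub>R x + v *\<^sub>R y - p i = u *\<^sub>R (x - p i) + v *\<^sub>R (y - p i)"
        by (simp add: algebra_simps)
      with xy show "u *\<^sub>R x + v *\<^sub>R y \<in> ?U"
        by (simp add: linear_add[OF linM] linear_cmul[OF linM] scaleR_add_right mult.commute)
    qed
    ultimately have "convex hull (A i) \<subseteq> ?U" by (intro hull_minimal) auto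
    with q show ?thesis by auto
  qed
  have msum_eq: "msum l (\<lambda>i. convex hull (A i)) = (+) (\<Sum>i<DIM('a). l i *\<^sub>R p i) ` (g ` (D l ` E))" for l
  proof -
    have eq: "(\<Sum>i<DIM('a). l i *\<^sub>R q i) = (\<Sum>i<DIM('a). l i *\<^sub>R p i) + g (D l (h ((\<Sum>i<DIM('a). q i) - (\<Sum>i<DIM('a). p i))))"
      if q: "\<forall>i<DIM('a). q i \<in> convex hull (A i)" for q
    proof -
      have "g (D l (h ((\<Sum>i<DIM('a). q i) - (\<Sum>i<DIM('a). p i)))) = M l (\<Sum>i<DIM('a). q i - p i)"
        by (simp add: M_def sum_subtractf)
      also have "\<dots> = (\<Sum>i<DIM('a). M l (q i - p i))"
        by (rule linear_sum[OF linM])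
      also have "\<dots> = (\<Sum>i<DIM('a). l i *\<^sub>R (q i - p i))"
        using q Mq by (intro sum.cong) auto
      finally show ?thesis by (simp add: scaleR_diff_right sum_subtractf)
    qed
    show ?thesis
    proof (intro set_eqI iffI)
      fix x assume "x \<in> msum l (\<lambda>i. convex hull (A i))"
      then obtain q where q: "\<forall>i<DIM('a). q i \<in> convex hull (A i)" "x = (\<Sum>i<DIM('a). l i *\<^sub>R q i)"
        unfolding mem_msum by blast
      then have "(\<Sum>i<DIM('a). q i) \<in> msum (\<lambda>_. 1) (\<lambda>i. convex hull (A i))"
        unfolding mem_msum by (intro exI[of _ q]) auto
      then show "x \<in> (+) (\<Sum>i<DIM('a). l i *\<^sub>R p i) ` (g ` (D l ` E))"
        unfolding q(2) eq[OF q(1)] E_def by blast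
    next
      fix x assume "x \<in> (+) (\<Sum>i<DIM('a). l i *\<^sub>R p i) ` (g ` (D l ` E))"
      then obtain s where s: "s \<in> msum (\<lambda>_. 1) (\<lambda>i. convex hull (A i))"
          "x = (\<Sum>i<DIM('a). l i *\<^sub>R p i) + g (D l (h (s - (\<Sum>i<DIM('a). p i))))"
        unfolding E_def by blast
      then obtain q where q: "\<forall>i<DIM('a). q i \<in> convex hull (A i)" "s = (\<Sum>i<DIM('a). 1 *\<^sub>R q i)"
        unfolding mem_msum by blast
      then have "x = (\<Sum>i<DIM('a). l i *\<^sub>R q i)" using s(2) eq[OF q(1)] by simp
      then show "x \<in> msum l (\<lambda>i. convex hull (A i))" using q(1) unfolding mem_msum by blast
    qed
  qed
  have cE: "compact E"
  proof -
    have "compact (msum (\<lambda>_. 1) (\<lambda>i. convex hull (A i)))"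
      using fin by (intro compact_msum finite_imp_compact_convex_hull) auto
    then show ?thesis unfolding E_def
      by (intro compact_continuous_image linear_continuous_on_compose[OF _ h(1)] continuous_intros)
  qed
  have cDE: "compact (D l ` E)" for l
    using cE unfolding D_def by (intro compact_continuous_image continuous_intros)
  have main: "measure lebesgue (msum l (\<lambda>i. convex hull (A i))) = (\<Prod>i<DIM('a). \<bar>l i\<bar> ^ (card (A i) - 1)) * (k * measure lebesgue E)" for l
  proof -
    have "measure lebesgue (msum l (\<lambda>i. convex hull (A i))) = k * ((\<Prod>b\<in>Basis. \<bar>l (fst (\<beta> b))\<bar>) * measure lebesgue E)"
      unfolding msum_eq measure_translation k[OF cDE] unfolding D_def measure_stretch_Basis[OF cE] ..
    also have "(\<Prod>b\<in>Basis. \<bar>l (fst (\<beta> b))\<bar>) = (\<Prod>x\<in>X. \<bar>l (fst x)\<bar>)"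
      by (rule prod.reindex_bij_betw[OF \<beta>])
    also have "\<dots> = (\<Prod>i<DIM('a). \<Prod>a\<in>A i - {p i}. \<bar>l i\<bar>)"
      unfolding X_def using fin by (subst prod.Sigma) (auto simp: split_beta)
    also have "\<dots> = (\<Prod>i<DIM('a). \<bar>l i\<bar> ^ (card (A i) - 1))"
      using fin p by (intro prod.cong) auto
    finally show ?thesis by simp
  qed
  \<comment> \<open>The formula for coefficients 1 evaluates the unknown factor
    \<open>k * measure lebesgue E\<close>.\<close>
  show ?thesis using main[of l] main[of "\<lambda>_. 1"] l by simp
qed

section \<open>Uniqueness of polynomial coefficients\<close>

lemma finite_mindex: "finite (mindex n)"
proof -
  have "mindex n = {\<alpha>. \<forall>i. (i \<in> {..<n} \<longrightarrow> \<alpha> i \<in> {..n}) \<and> (i \<notin> {..<n} \<longrightarrow> \<alpha> i = 0)}"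
    by (simp add: mindex_def not_less)
  also have "finite \<dots>"
    by (rule finite_set_of_finite_funs) simp_all
  finally show ?thesis .
qed

text \<open>Reduction modulo \<open>B\<close> identifies the lowest digit; removing it and dividing
  by \<open>B\<close> leaves a shorter expansion.\<close>

lemma digits_unique:
  fixes B :: nat
  assumes "\<And>i. i < m \<Longrightarrow> \<alpha> i < B" "\<And>i. i < m \<Longrightarrow> \<beta> i < B"
    and "(\<Sum>i<m. \<alpha> i * B ^ i) = (\<Sum>i<m. \<beta> i * B ^ i)" and "i < m"
  shows "\<alpha> i = \<beta> i"
  using assms
proof (induction m arbitrary: \<alpha> \<beta> i)
  case (Suc m)
  have split: "(\<Sum>i<Suc m. f i * B ^ i) = f 0 + B * (\<Sum>i<m. f (Suc i) * B ^ i)" for f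
    by (subst sum.lessThan_Suc_shift) (simp add: sum_distrib_left mult.left_commute)
  have lt: "\<alpha> 0 < B" "\<beta> 0 < B" using Suc.prems by auto
  have eq: "\<alpha> 0 + B * (\<Sum>i<m. \<alpha> (Suc i) * B ^ i) = \<beta> 0 + B * (\<Sum>i<m. \<beta> (Suc i) * B ^ i)"
    using Suc.prems(3) unfolding split .
  have 0: "\<alpha> 0 = \<beta> 0"
    using arg_cong[OF eq, of "\<lambda>x. x mod B"] lt by simp
  have "(\<Sum>i<m. \<alpha> (Suc i) * B ^ i) = (\<Sum>i<m. \<beta> (Suc i) * B ^ i)"
    using eq 0 lt by simp
  then have "\<alpha> (Suc j) = \<beta> (Suc j)" if "j < m" for j
    using Suc.IH[of "\<lambda>i. \<alpha> (Suc i)" "\<lambda>i. \<beta> (Suc i)" j] Suc.prems(1,2) that by auto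
  then show ?case using 0 Suc.prems(4) by (cases i) auto
qed simp

text \<open>Kronecker substitution \<open>l i = t ^ ((n + 1) ^ i)\<close> reduces the uniqueness of coefficients to
  polynomials in the single variable \<open>t\<close>.\<close>

lemma mindex_coeff_unique:
  fixes a b :: "(nat \<Rightarrow> nat) \<Rightarrow> real"
  assumes eq: "\<And>l :: nat \<Rightarrow> real. (\<forall>i. 0 \<le> l i) \<Longrightarrow>
      (\<Sum>\<alpha>\<in>mindex n. a \<alpha> * (\<Prod>i<n. l i ^ \<alpha> i)) = (\<Sum>\<alpha>\<in>mindex n. b \<alpha> * (\<Prod>i<n. l i ^ \<alpha> i))"
    and \<gamma>: "\<gamma> \<in> mindex n"
  shows "a \<gamma> = b \<gamma>"
proof -
  \<comment> \<open>The exponents are at most \<open>n\<close>, so they are digits in base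
    \<open>n + 1\<close> and distinct multi-indices receive distinct codes.\<close>
  define code where "code \<alpha> = (\<Sum>i<n. \<alpha> i * (n + 1) ^ i)" for \<alpha> :: "nat \<Rightarrow> nat"
  define c where "c k = (\<Sum>\<alpha>\<in>{\<alpha>\<in>mindex n. code \<alpha> = k}. a \<alpha> - b \<alpha>)" for k
  define N where "N = Max (code ` mindex n)"
  have N: "code \<alpha> \<le> N" if "\<alpha> \<in> mindex n" for \<alpha>
    unfolding N_def using that finite_mindex by auto
  have inj: "inj_on code (mindex n)"
  proof (rule inj_onI)
    fix \<alpha> \<beta> assume "\<alpha> \<in> mindex n" "\<beta> \<in> mindex n" "code \<alpha> = code \<beta>"
    then have "\<alpha> i = \<beta> i" for i
      using digits_unique[of n \<alpha> "n + 1" \<beta> i] by (cases "i < n") (auto simp: mindex_def code_def le_imp_less_Suc)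
    then show "\<alpha> = \<beta>" by auto
  qed
  have "(\<Sum>k\<le>N. c k * t ^ k) = 0" if t: "t \<ge> 0" for t :: real
  proof -
    have "(\<Prod>i<n. (t ^ ((n + 1) ^ i)) ^ \<alpha> i) = t ^ code \<alpha>" for \<alpha>
      by (simp add: code_def power_sum mult.commute flip: power_mult)
    then have "(\<Sum>\<alpha>\<in>mindex n. (a \<alpha> - b \<alpha>) * t ^ code \<alpha>) = 0"
      using eq[of "\<lambda>i. t ^ ((n + 1) ^ i)"] t by (simp add: left_diff_distrib sum_subtractf)
    moreover have "(\<Sum>k\<le>N. c k * t ^ k) = (\<Sum>k\<le>N. \<Sum>\<alpha>\<in>{\<alpha>\<in>mindex n. code \<alpha> = k}. (a \<alpha> - b \<alpha>) * t ^ code \<alpha>)"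
      unfolding c_def sum_distrib_right by (intro sum.cong) auto
    moreover have "\<dots> = (\<Sum>\<alpha>\<in>mindex n. (a \<alpha> - b \<alpha>) * t ^ code \<alpha>)"
      by (rule sum.group[OF finite_mindex]) (use N in auto)
    ultimately show ?thesis by simp
  qed
  \<comment> \<open>A polynomial that vanishes on a half-line has infinitely many roots, so all its
    coefficients are 0.\<close>
  then have "{0..} \<subseteq> {t. (\<Sum>k\<le>N. c k * t ^ k) = 0}" by auto
  then have "\<not> finite {t::real. (\<Sum>k\<le>N. c k * t ^ k) = 0}"
    using infinite_Ici finite_subset by blast
  then have "c (code \<gamma>) = 0"
    using polyfun_finite_roots[of c N] N[OF \<gamma>] by blast
  moreover have "{\<alpha>\<in>mindex n. code \<alpha> = code \<gamma>} = {\<gamma>}"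
    using inj \<gamma> by (auto dest: inj_onD)
  ultimately show ?thesis by (simp add: c_def)
qed

text \<open>If every cell were all of \<open>A i\<close>, then \<open>c i a\<close> would be
  \<open>y \<bullet> a\<close> minus a constant depending only on \<open>i\<close>. Pairing this
  with \<open>c\<close> and using both relations makes the sum of the squares of \<open>c\<close>
  vanish, against \<open>c j b \<noteq> 0\<close>.\<close>

lemma relation_cells_smaller:
  fixes A :: "nat \<Rightarrow> 'a::euclidean_space set"
  assumes fin: "\<And>i. i < DIM('a) \<Longrightarrow> finite (A i) \<and> A i \<noteq> {}"
    and c0: "\<And>i. i < DIM('a) \<Longrightarrow> (\<Sum>a\<in>A i. c i a) = 0"
    and c1: "(\<Sum>i<DIM('a). \<Sum>a\<in>A i. c i a *\<^sub>R a) = 0"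
    and j: "j < DIM('a)" "b \<in> A j" "c j b \<noteq> 0"
  shows "(\<Sum>i<DIM('a). card (cell (c i) (A i) y)) < (\<Sum>i<DIM('a). card (A i))"
proof -
  have "\<exists>i<DIM('a). cell (c i) (A i) y \<noteq> A i"
  proof (rule ccontr)
    assume "\<not> ?thesis"
    then have all: "y \<bullet> a - c i a = conjugate (c i) (A i) y" if "i < DIM('a)" "a \<in> A i" for i a
      using fin[OF that(1)] that mem_cell_iff[of "A i" a "c i" y] by auto
    have "0 = (\<Sum>i<DIM('a). conjugate (c i) (A i) y * (\<Sum>a\<in>A i. c i a))"
      using c0 by simp
    also have "\<dots> = (\<Sum>i<DIM('a). \<Sum>a\<in>A i. c i a * (y \<bullet> a - c i a))"
      unfolding sum_distrib_left using all by (intro sum.cong) (auto simp: mult.commute)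
    also have "\<dots> = y \<bullet> (\<Sum>i<DIM('a). \<Sum>a\<in>A i. c i a *\<^sub>R a) - (\<Sum>i<DIM('a). \<Sum>a\<in>A i. c i a * c i a)"
      by (simp add: inner_sum_right right_diff_distrib sum_subtractf)
    finally have "(\<Sum>i<DIM('a). \<Sum>a\<in>A i. c i a * c i a) = 0" using c1 by simp
    then have "(\<Sum>a\<in>A j. c j a * c j a) = 0"
      using j(1) by (subst (asm) sum_nonneg_eq_0_iff) (auto intro!: sum_nonneg)
    then have "c j b * c j b = 0"
      using fin[OF j(1)] j(2) by (subst (asm) sum_nonneg_eq_0_iff) auto
    with j(3) show False by simp
  qed
  then obtain i where i: "i < DIM('a)" "cell (c i) (A i) y \<subset> A i" using cell_subset by blast
  show ?thesis
  proof (rule sum_strict_mono_ex1)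
    show "\<forall>i\<in>{..<DIM('a)}. card (cell (c i) (A i) y) \<le> card (A i)"
      using fin by (auto intro!: card_mono cell_subset)
    show "\<exists>i\<in>{..<DIM('a)}. card (cell (c i) (A i) y) < card (A i)"
      using i fin by (auto intro!: bexI[of _ i] psubset_card_mono)
  qed simp
qed

text \<open>Independence is formulated for an indexed family because edge vectors of different
  \<open>A i\<close> could coincide; a repeated vector would give a relation with coefficients 1 and
  -1.\<close>

lemma card_independent_family_le:
  fixes v :: "'i \<Rightarrow> 'a::euclidean_space"
  assumes fin: "finite X"
    and ind: "\<And>c. (\<Sum>x\<in>X. c x *\<^sub>R v x) = 0 \<Longrightarrow> \<forall>x\<in>X. c x = 0"
  shows "card X \<le> DIM('a)"
proof -
  have inj: "inj_on v X"
  proof (rule inj_onI, rule ccontr)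
    fix x y assume xy: "x \<in> X" "y \<in> X" "v x = v y" "x \<noteq> y"
    let ?c = "\<lambda>z. (if z = x then 1 else 0) - (if z = y then 1 else 0) :: real"
    have "(\<Sum>z\<in>X. ?c z *\<^sub>R v z) = (\<Sum>z\<in>X. if z = x then v z else 0) - (\<Sum>z\<in>X. if z = y then v z else 0)"
      by (subst sum_subtractf[symmetric]) (auto intro!: sum.cong simp: algebra_simps)
    also have "\<dots> = 0" using xy fin by simp
    finally have "?c x = 0" using ind[of ?c] xy by blast
    with xy show False by simp
  qed
  have "independent (v ` X)"
    unfolding independent_explicit
  proof (intro conjI allI impI)
    fix u assume "(\<Sum>w\<in>v ` X. u w *\<^sub>R w) = 0"
    then have "(\<Sum>x\<in>X. u (v x) *\<^sub>R v x) = 0" by (simp add: sum.reindex[OF inj])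
    then show "\<forall>w\<in>v ` X. u w = 0" using ind[of "\<lambda>x. u (v x)"] by auto
  qed (use fin in simp)
  then show ?thesis using independent_bound card_image[OF inj] by metis
qed

text \<open>Without relations the edge vectors from the base points are independent, so there are at
  most \<open>DIM('a)\<close> of them; since they span, there are at least as many.\<close>

lemma card_simplices:
  fixes A :: "nat \<Rightarrow> 'a::euclidean_space set"
  assumes fin: "\<And>i. i < DIM('a) \<Longrightarrow> finite (A i) \<and> A i \<noteq> {}"
    and span: "span (differences {..<DIM('a)} A) = UNIV"
    and ind: "\<And>c i a. \<lbrakk>\<And>i. i < DIM('a) \<Longrightarrow> (\<Sum>a\<in>A i. c i a) = 0;
       (\<Sum>i<DIM('a). \<Sum>a\<in>A i. c i a *\<^sub>R a) = 0; i < DIM('a); a \<in> A i\<rbrakk> \<Longrightarrow> c i a = 0"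
  shows "(\<Sum>i<DIM('a). card (A i) - 1) = DIM('a)"
proof -
  have "\<forall>i. \<exists>q. i < DIM('a) \<longrightarrow> q \<in> A i" using fin by blast
  then obtain p where p: "\<And>i. i < DIM('a) \<Longrightarrow> p i \<in> A i" by metis
  define X where "X = (SIGMA i:{..<DIM('a)}. A i - {p i})"
  define v where "v = (\<lambda>(i, a). a - p i)"
  have finX: "finite X" unfolding X_def using fin by auto
  have cardX: "card X = (\<Sum>i<DIM('a). card (A i) - 1)"
    unfolding X_def using fin p by (subst card_SigmaI) auto
  have "card X \<le> DIM('a)"
  proof (rule card_independent_family_le[OF finX])
    fix c assume c: "(\<Sum>x\<in>X. c x *\<^sub>R v x) = 0"
    \<comment> \<open>The base point receives minus the sum of the other coefficients, which turns a
      linear relation among edge vectors into one whose coefficients sum to 0 on each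
      \<open>A i\<close>.\<close>
    define c' where "c' i a = (if a = p i then - (\<Sum>a\<in>A i - {p i}. c (i, a)) else c (i, a))" for i a
    have 0: "(\<Sum>a\<in>A i. c' i a) = 0" if i: "i < DIM('a)" for i
    proof -
      have "(\<Sum>a\<in>A i. c' i a) = c' i (p i) + (\<Sum>a\<in>A i - {p i}. c' i a)"
        using fin[OF i] p[OF i] by (intro sum.remove) auto
      also have "(\<Sum>a\<in>A i - {p i}. c' i a) = (\<Sum>a\<in>A i - {p i}. c (i, a))"
        by (intro sum.cong) (auto simp: c'_def)
      finally show ?thesis by (simp add: c'_def)
    qed
    have 1: "(\<Sum>a\<in>A i. c' i a *\<^sub>R a) = (\<Sum>a\<in>A i - {p i}. c (i, a) *\<^sub>R (a - p i))" if i: "i < DIM('a)" for i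
    proof -
      have "(\<Sum>a\<in>A i. c' i a *\<^sub>R a) = (\<Sum>a\<in>A i. c' i a *\<^sub>R a) - (\<Sum>a\<in>A i. c' i a) *\<^sub>R p i"
        using 0[OF i] by simp
      also have "\<dots> = (\<Sum>a\<in>A i. c' i a *\<^sub>R (a - p i))"
        by (simp add: scaleR_diff_right sum_subtractf scaleR_left.sum)
      also have "\<dots> = (\<Sum>a\<in>A i - {p i}. c' i a *\<^sub>R (a - p i))"
        using fin[OF i] by (intro sum.mono_neutral_right) auto
      also have "\<dots> = (\<Sum>a\<in>A i - {p i}. c (i, a) *\<^sub>R (a - p i))"
        by (intro sum.cong) (auto simp: c'_def)
      finally show ?thesis .
    qed
    have "(\<Sum>i<DIM('a). \<Sum>a\<in>A i. c' i a *\<^sub>R a) = (\<Sum>i<DIM('a). \<Sum>a\<in>A i - {p i}. c (i, a) *\<^sub>R (a - p i))"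
      by (rule sum.cong) (simp_all add: 1)
    also have "\<dots> = (\<Sum>x\<in>X. c x *\<^sub>R v x)"
      unfolding X_def v_def using fin by (subst sum.Sigma) (auto simp: split_beta)
    finally have 2: "(\<Sum>i<DIM('a). \<Sum>a\<in>A i. c' i a *\<^sub>R a) = 0" using c by simp
    show "\<forall>x\<in>X. c x = 0"
    proof
      fix x assume "x \<in> X"
      then obtain i a where "x = (i, a)" "i < DIM('a)" "a \<in> A i" "a \<noteq> p i" by (auto simp: X_def)
      then show "c x = 0" using ind[of c' i a, OF 0 2] by (auto simp: c'_def)
    qed
  qed
  moreover have "DIM('a) \<le> card X"
  proof -
    have "a - p i \<in> span (v ` X)" if "i < DIM('a)" "a \<in> A i" for i a
    proof (cases "a = p i")
      case True then show ?thesis by (simp add: span_zero)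
    next
      case False
      then have "(i, a) \<in> X" using that by (auto simp: X_def)
      then show ?thesis by (auto intro!: span_base simp: v_def image_iff)
    qed
    then have "(a - p i) - (b - p i) \<in> span (v ` X)" if "i < DIM('a)" "a \<in> A i" "b \<in> A i" for i a b
      using that span_diff by blast
    then have "differences {..<DIM('a)} A \<subseteq> span (v ` X)" by (auto simp: differences_def)
    then have "UNIV \<subseteq> span (v ` X)" using span span_minimal subspace_span by blast
    then have "dim (UNIV :: 'a set) \<le> card (v ` X)" using finX by (intro dim_le_card) auto
    then show ?thesis using card_image_le[OF finX, of v] by simp
  qed
  ultimately show ?thesis using cardX by simp
qed

section \<open>Coefficients of the volume polynomial\<close>

definition vol_coeffs :: "(nat \<Rightarrow> 'a::euclidean_space set) \<Rightarrow> ((nat \<Rightarrow> nat) \<Rightarrow> real) \<Rightarrow> bool" where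
  "vol_coeffs K a \<longleftrightarrow> (\<forall>l. (\<forall>i. 0 \<le> l i) \<longrightarrow>
     measure lebesgue (msum l K) = (\<Sum>\<alpha>\<in>mindex DIM('a). a \<alpha> * (\<Prod>i<DIM('a). l i ^ \<alpha> i)))"

definition spanning_segments :: "(nat \<Rightarrow> 'a::euclidean_space set) \<Rightarrow> bool" where
  "spanning_segments K \<longleftrightarrow> (\<exists>p q. (\<forall>i<DIM('a). p i \<in> K i \<and> q i \<in> K i) \<and>
     span ((\<lambda>i. p i - q i) ` {..<DIM('a)}) = UNIV)"

lemma spanning_segments_mono:
  fixes K L :: "nat \<Rightarrow> 'a::euclidean_space set"
  assumes "spanning_segments K" "\<And>i. i < DIM('a) \<Longrightarrow> K i \<subseteq> L i"
  shows "spanning_segments L"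
proof -
  obtain p q where "\<forall>i<DIM('a). p i \<in> K i \<and> q i \<in> K i" "span ((\<lambda>i. p i - q i) ` {..<DIM('a)}) = UNIV"
    using assms(1) unfolding spanning_segments_def by blast
  with assms(2) show ?thesis
    unfolding spanning_segments_def by (intro exI[of _ p] exI[of _ q]) auto
qed

text \<open>Uniqueness of coefficients makes the definite description in \<open>mixed_volume\<close>
  well defined, so any valid coefficient function evaluates it.\<close>

lemma mixed_volume_eq:
  fixes K :: "nat \<Rightarrow> 'a::euclidean_space set"
  assumes "vol_coeffs K a"
  shows "mixed_volume K = a (\<lambda>i. if i < DIM('a) then 1 else 0)"
  unfolding mixed_volume_def msum_def[symmetric] vol_coeffs_def[symmetric]
proof (rule the_equality)
  show "\<exists>b. vol_coeffs K b \<and> a (\<lambda>i. if i < DIM('a) then 1 else 0) = b (\<lambda>i. if i < DIM('a) then 1 else 0)"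
    using assms by blast
next
  fix c assume "\<exists>b. vol_coeffs K b \<and> c = b (\<lambda>i. if i < DIM('a) then 1 else 0)"
  then obtain b where b: "vol_coeffs K b" "c = b (\<lambda>i. if i < DIM('a) then 1 else 0)" by blast
  have "(\<lambda>i. if i < DIM('a) then 1 else 0) \<in> mindex DIM('a)"
    by (simp add: mindex_def Suc_leI)
  then have "b (\<lambda>i. if i < DIM('a) then 1 else 0) = a (\<lambda>i. if i < DIM('a) then 1 else 0)"
    by (rule mindex_coeff_unique[rotated]) (use assms b(1) in \<open>simp add: vol_coeffs_def\<close>)
  with b(2) show "c = a (\<lambda>i. if i < DIM('a) then 1 else 0)" by simp
qed

lemma mixed_volume_cong:
  fixes K L :: "nat \<Rightarrow> 'a::euclidean_space set"
  assumes "\<And>i. i < DIM('a) \<Longrightarrow> K i = L i"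
  shows "mixed_volume K = mixed_volume L"
proof -
  have "(\<Sum>i<DIM('a). (\<lambda>x. l i *\<^sub>R x) ` K i) = (\<Sum>i<DIM('a). (\<lambda>x. l i *\<^sub>R x) ` L i)" for l
    using assms by simp
  then show ?thesis by (simp only: mixed_volume_def)
qed

lemma vol_coeffs_negligible:
  fixes A :: "nat \<Rightarrow> 'a::euclidean_space set"
  assumes "span (differences {..<DIM('a)} A) \<noteq> UNIV"
  shows "vol_coeffs (\<lambda>i. convex hull (A i)) (\<lambda>_. 0)"
proof -
  have "measure lebesgue (msum l (\<lambda>i. convex hull (A i))) = 0" for l
    by (intro negligible_imp_measure0 negligible_msum assms)
  then show ?thesis by (simp add: vol_coeffs_def)
qed

text \<open>The breakpoints do not depend on \<open>l\<close>, so additivity of the volume over the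
  cells is an identity between polynomials in \<open>l\<close>.\<close>

lemma vol_coeffs_sum:
  fixes A :: "nat \<Rightarrow> 'a::euclidean_space set"
  assumes fin: "\<And>i. i < DIM('a) \<Longrightarrow> finite (A i) \<and> A i \<noteq> {}"
    and a: "\<And>y. y \<in> breakpoints w A \<Longrightarrow> vol_coeffs (\<lambda>i. convex hull (cell (w i) (A i) y)) (a y)"
  shows "vol_coeffs (\<lambda>i. convex hull (A i)) (\<lambda>\<alpha>. \<Sum>y\<in>breakpoints w A. a y \<alpha>)"
  unfolding vol_coeffs_def
proof (intro allI impI)
  fix l :: "nat \<Rightarrow> real" assume l: "\<forall>i. 0 \<le> l i"
  have "measure lebesgue (msum l (\<lambda>i. convex hull (A i))) =
      (\<Sum>y\<in>breakpoints w A. measure lebesgue (msum l (\<lambda>i. convex hull (cell (w i) (A i) y))))"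
    using fin l by (intro measure_msum_subdivision) auto
  also have "\<dots> = (\<Sum>y\<in>breakpoints w A. \<Sum>\<alpha>\<in>mindex DIM('a). a y \<alpha> * (\<Prod>i<DIM('a). l i ^ \<alpha> i))"
    using a l by (intro sum.cong) (auto simp: vol_coeffs_def)
  also have "\<dots> = (\<Sum>\<alpha>\<in>mindex DIM('a). (\<Sum>y\<in>breakpoints w A. a y \<alpha>) * (\<Prod>i<DIM('a). l i ^ \<alpha> i))"
    by (subst sum.swap) (simp add: sum_distrib_right)
  finally show "measure lebesgue (msum l (\<lambda>i. convex hull (A i))) =
      (\<Sum>\<alpha>\<in>mindex DIM('a). (\<Sum>y\<in>breakpoints w A. a y \<alpha>) * (\<Prod>i<DIM('a). l i ^ \<alpha> i))" .
qed

lemma vol_coeffs_simplices: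
  fixes A :: "nat \<Rightarrow> 'a::euclidean_space set"
  assumes fin: "\<And>i. i < DIM('a) \<Longrightarrow> finite (A i) \<and> A i \<noteq> {}"
    and span: "span (differences {..<DIM('a)} A) = UNIV"
    and card: "(\<Sum>i<DIM('a). card (A i) - 1) = DIM('a)"
  shows "vol_coeffs (\<lambda>i. convex hull (A i))
    (\<lambda>\<alpha>. if \<alpha> = (\<lambda>i. if i < DIM('a) then card (A i) - 1 else 0)
          then measure lebesgue (msum (\<lambda>_. 1) (\<lambda>i. convex hull (A i))) else 0)"
  unfolding vol_coeffs_def
proof (intro allI impI)
  fix l :: "nat \<Rightarrow> real" assume l: "\<forall>i. 0 \<le> l i"
  define k where "k = (\<lambda>i. if i < DIM('a) then card (A i) - 1 else 0)"
  define m where "m = measure lebesgue (msum (\<lambda>_. 1) (\<lambda>i. convex hull (A i)))"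
  \<comment> \<open>Each exponent is bounded by the total degree, so the monomial occurs in the
    index set \<open>mindex\<close>.\<close>
  have "card (A i) - 1 \<le> DIM('a)" if "i < DIM('a)" for i
    using member_le_sum[of i "{..<DIM('a)}" "\<lambda>i. card (A i) - 1"] that card by simp
  then have k: "k \<in> mindex DIM('a)" by (simp add: mindex_def k_def)
  have "measure lebesgue (msum l (\<lambda>i. convex hull (A i))) = (\<Prod>i<DIM('a). l i ^ (card (A i) - 1)) * m"
    unfolding m_def using l by (intro measure_msum_simplices fin span card) auto
  also have "\<dots> = (\<Sum>\<alpha>\<in>{k}. m * (\<Prod>i<DIM('a). l i ^ \<alpha> i))"
    by (simp add: k_def)
  also have "\<dots> = (\<Sum>\<alpha>\<in>mindex DIM('a). (if \<alpha> = k then m else 0) * (\<Prod>i<DIM('a). l i ^ \<alpha> i))"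
    using k finite_mindex by (intro sum.mono_neutral_cong_left) auto
  finally show "measure lebesgue (msum l (\<lambda>i. convex hull (A i))) =
      (\<Sum>\<alpha>\<in>mindex DIM('a). (if \<alpha> = (\<lambda>i. if i < DIM('a) then card (A i) - 1 else 0)
          then measure lebesgue (msum (\<lambda>_. 1) (\<lambda>i. convex hull (A i))) else 0) * (\<Prod>i<DIM('a). l i ^ \<alpha> i))"
    unfolding k_def m_def .
qed

text \<open>An affine relation \<open>c\<close> among the points can itself be used as the weight function: it is then
  not the restriction of affine functions of equal slope, so every cell omits a point. Without such a
  relation the Minkowski sum is a linear image of a product of simplices.\<close>

theorem vol_coeffs_exist:
  fixes A :: "nat \<Rightarrow> 'a::euclidean_space set"
  assumes "\<And>i. i < DIM('a) \<Longrightarrow> finite (A i) \<and> A i \<noteq> {}"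
  shows "\<exists>a. vol_coeffs (\<lambda>i. convex hull (A i)) a \<and> (\<forall>\<alpha>. 0 \<le> a \<alpha>) \<and>
    (0 < a (\<lambda>i. if i < DIM('a) then 1 else 0) \<longrightarrow> spanning_segments A)"
  using assms
proof (induction "\<Sum>i<DIM('a). card (A i)" arbitrary: A rule: less_induct)
  case less
  note fin = less.prems
  let ?one = "\<lambda>i. if i < DIM('a) then 1 else 0 :: nat"
  define relation where "relation c \<longleftrightarrow> (\<forall>i<DIM('a). (\<Sum>a\<in>A i. c i a) = 0) \<and>
      (\<Sum>i<DIM('a). \<Sum>a\<in>A i. c i a *\<^sub>R a) = 0 \<and> (\<exists>i<DIM('a). \<exists>a\<in>A i. c i a \<noteq> 0)"
    for c :: "nat \<Rightarrow> 'a \<Rightarrow> real"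
  show ?case
  proof (cases "\<exists>c. relation c")
    case True
    then obtain c j b where c: "\<And>i. i < DIM('a) \<Longrightarrow> (\<Sum>a\<in>A i. c i a) = 0"
        "(\<Sum>i<DIM('a). \<Sum>a\<in>A i. c i a *\<^sub>R a) = 0" "j < DIM('a)" "b \<in> A j" "c j b \<noteq> 0"
      unfolding relation_def by blast
    let ?C = "\<lambda>y i. cell (c i) (A i) y"
    have "\<exists>a. vol_coeffs (\<lambda>i. convex hull (?C y i)) a \<and> (\<forall>\<alpha>. 0 \<le> a \<alpha>) \<and>
        (0 < a ?one \<longrightarrow> spanning_segments (?C y))" for y
    proof (rule less.hyps)
      show "(\<Sum>i<DIM('a). card (?C y i)) < (\<Sum>i<DIM('a). card (A i))"
        by (rule relation_cells_smaller[where A=A, OF fin c])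
      show "finite (?C y i) \<and> ?C y i \<noteq> {}" if "i < DIM('a)" for i
        using fin[OF that] cell_nonempty finite_subset[OF cell_subset] by blast
    qed
    then obtain a where a: "\<And>y. vol_coeffs (\<lambda>i. convex hull (?C y i)) (a y)" "\<And>y \<alpha>. 0 \<le> a y \<alpha>"
        "\<And>y. 0 < a y ?one \<Longrightarrow> spanning_segments (?C y)" by metis
    show ?thesis
    proof (intro exI conjI allI impI)
      show "vol_coeffs (\<lambda>i. convex hull (A i)) (\<lambda>\<alpha>. \<Sum>y\<in>breakpoints c A. a y \<alpha>)"
        by (intro vol_coeffs_sum fin a)
      show "0 \<le> (\<Sum>y\<in>breakpoints c A. a y \<alpha>)" for \<alpha>
        by (intro sum_nonneg a)
      \<comment> \<open>Some cell contributes a positive coefficient, and segments in that cell are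
        segments in \<open>A\<close>.\<close>
      assume "0 < (\<Sum>y\<in>breakpoints c A. a y ?one)"
      then obtain y where "0 < a y ?one"
        by (metis sum_nonpos not_less)
      from spanning_segments_mono[OF a(3)[OF this] cell_subset] show "spanning_segments A" .
    qed
  next
    case False
    show ?thesis
    proof (cases "span (differences {..<DIM('a)} A) = UNIV")
      case span: True
      have card: "(\<Sum>i<DIM('a). card (A i) - 1) = DIM('a)"
      proof (rule card_simplices[where A=A, OF fin span])
        fix c :: "nat \<Rightarrow> 'a \<Rightarrow> real" and i a
        assume c: "\<And>i. i < DIM('a) \<Longrightarrow> (\<Sum>a\<in>A i. c i a) = 0"
          "(\<Sum>i<DIM('a). \<Sum>a\<in>A i. c i a *\<^sub>R a) = 0" "i < DIM('a)" "a \<in> A i"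
        show "c i a = 0"
        proof (rule ccontr)
          assume "c i a \<noteq> 0"
          then have "\<exists>i<DIM('a). \<exists>a\<in>A i. c i a \<noteq> 0" using c(3,4) by blast
          with c(1,2) have "relation c" unfolding relation_def by (intro conjI allI impI)
          with False show False by blast
        qed
      qed
      show ?thesis
      proof (intro exI conjI allI impI)
        show "vol_coeffs (\<lambda>i. convex hull (A i))
          (\<lambda>\<alpha>. if \<alpha> = (\<lambda>i. if i < DIM('a) then card (A i) - 1 else 0)
             then measure lebesgue (msum (\<lambda>_. 1) (\<lambda>i. convex hull (A i))) else 0)"
          by (rule vol_coeffs_simplices[where A=A, OF fin span card])
        assume pos: "0 < (if ?one = (\<lambda>i. if i < DIM('a) then card (A i) - 1 else 0)
             then measure lebesgue (msum (\<lambda>_. 1) (\<lambda>i. convex hull (A i))) else 0)"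
        \<comment> \<open>There is only one monomial, so a positive mixed coefficient means that it
          is the product of all \<open>l i\<close>; hence every \<open>A i\<close> consists of two
          points.\<close>
        have eq: "?one = (\<lambda>i. if i < DIM('a) then card (A i) - 1 else 0)"
        proof (rule ccontr)
          assume "\<not> ?thesis"
          with pos show False by (simp only: if_False less_irrefl)
        qed
        have "\<exists>p q. A i = {p, q}" if i: "i < DIM('a)" for i
        proof -
          have "card (A i) - 1 = 1" using fun_cong[OF eq, of i] i by simp
          then have "card (A i) = 2" by simp
          then show ?thesis by (auto simp: card_2_iff)
        qed
        then have "\<forall>i. \<exists>p q. i < DIM('a) \<longrightarrow> A i = {p, q}" by blast
        then obtain p q where pq: "\<And>i. i < DIM('a) \<Longrightarrow> A i = {p i, q i}" by metis
        have "v \<in> span ((\<lambda>i. p i - q i) ` {..<DIM('a)})" if "v \<in> differences {..<DIM('a)} A" for v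
        proof -
          obtain i a b where i: "i < DIM('a)" "a \<in> A i" "b \<in> A i" "v = a - b"
            using \<open>v \<in> differences {..<DIM('a)} A\<close> by (auto simp: differences_def)
          then have v: "v \<in> {0, p i - q i, - (p i - q i)}" using pq[OF i(1)] by auto
          have "p i - q i \<in> span ((\<lambda>i. p i - q i) ` {..<DIM('a)})"
            using i(1) by (intro span_base) auto
          then show ?thesis using v span_neg span_zero by blast
        qed
        then have "span (differences {..<DIM('a)} A) \<subseteq> span ((\<lambda>i. p i - q i) ` {..<DIM('a)})"
          by (intro span_minimal) auto
        then show "spanning_segments A"
          unfolding spanning_segments_def span using pq by (intro exI[of _ p] exI[of _ q]) auto
      qed auto
    next
      case False
      then show ?thesis using vol_coeffs_negligible by (intro exI[of _ "\<lambda>_. 0"]) auto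
    qed
  qed
qed

section \<open>Mixed volumes of cells\<close>

lemma mixed_volume_nonneg:
  fixes A :: "nat \<Rightarrow> 'a::euclidean_space set"
  assumes "\<And>i. i < DIM('a) \<Longrightarrow> finite (A i) \<and> A i \<noteq> {}"
  shows "0 \<le> mixed_volume (\<lambda>i. convex hull (A i))"
proof -
  obtain a where "vol_coeffs (\<lambda>i. convex hull (A i)) a" "\<forall>\<alpha>. 0 \<le> a \<alpha>"
    using vol_coeffs_exist[of A] assms by blast
  then show ?thesis by (simp add: mixed_volume_eq)
qed

lemma mixed_volume_pos_imp_spanning_segments:
  fixes A :: "nat \<Rightarrow> 'a::euclidean_space set"
  assumes "\<And>i. i < DIM('a) \<Longrightarrow> finite (A i) \<and> A i \<noteq> {}"
    and "0 < mixed_volume (\<lambda>i. convex hull (A i))"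
  shows "spanning_segments A"
proof -
  obtain a where "vol_coeffs (\<lambda>i. convex hull (A i)) a"
      "0 < a (\<lambda>i. if i < DIM('a) then 1 else 0) \<longrightarrow> spanning_segments A"
    using vol_coeffs_exist[of A] assms(1) by blast
  then show ?thesis using assms(2) mixed_volume_eq[of "\<lambda>i. convex hull (A i)" a] by simp
qed

text \<open>Slopes other than breakpoints have degenerate cells and contribute 0, so the sum may run
  over a larger set that includes prescribed slopes.\<close>

theorem mixed_volume_subdivision:
  fixes A :: "nat \<Rightarrow> 'a::euclidean_space set"
  assumes fin: "\<And>i. i < DIM('a) \<Longrightarrow> finite (A i) \<and> A i \<noteq> {}"
    and S: "finite S" "breakpoints w A \<subseteq> S"
  shows "mixed_volume (\<lambda>i. convex hull (A i)) =
    (\<Sum>y\<in>S. mixed_volume (\<lambda>i. convex hull (cell (w i) (A i) y)))"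
proof -
  have "\<exists>a. vol_coeffs (\<lambda>i. convex hull (cell (w i) (A i) y)) a" for y
    using vol_coeffs_exist[of "\<lambda>i. cell (w i) (A i) y"] fin cell_nonempty finite_subset[OF cell_subset]
    by blast
  then obtain a where a: "\<And>y. vol_coeffs (\<lambda>i. convex hull (cell (w i) (A i) y)) (a y)" by metis
  have "mixed_volume (\<lambda>i. convex hull (A i)) =
      (\<Sum>y\<in>breakpoints w A. mixed_volume (\<lambda>i. convex hull (cell (w i) (A i) y)))"
    using mixed_volume_eq[OF vol_coeffs_sum[OF fin a]] mixed_volume_eq[OF a] by simp
  also have "\<dots> = (\<Sum>y\<in>S. mixed_volume (\<lambda>i. convex hull (cell (w i) (A i) y)))"
    using S
  proof (intro sum.mono_neutral_left ballI)
    fix y assume "y \<in> S - breakpoints w A"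
    then have "vol_coeffs (\<lambda>i. convex hull (cell (w i) (A i) y)) (\<lambda>_. 0)"
      by (intro vol_coeffs_negligible) (auto simp: breakpoints_def)
    then show "mixed_volume (\<lambda>i. convex hull (cell (w i) (A i) y)) = 0"
      using mixed_volume_eq by metis
  qed auto
  finally show ?thesis .
qed

lemma mixed_volume_cell_nonneg:
  fixes A :: "nat \<Rightarrow> 'a::euclidean_space set"
  assumes fin: "\<And>i. i < DIM('a) \<Longrightarrow> finite (A i) \<and> A i \<noteq> {}"
  shows "0 \<le> mixed_volume (\<lambda>i. convex hull (cell (w i) (A i) y))"
proof (rule mixed_volume_nonneg)
  show "finite (cell (w i) (A i) y) \<and> cell (w i) (A i) y \<noteq> {}" if "i < DIM('a)" for i
    using fin[OF that] cell_nonempty finite_subset[OF cell_subset] by blast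
qed

text \<open>All terms of the subdivision formula are nonnegative, so any two of them are bounded by
  the total, whether or not their slopes are breakpoints.\<close>

lemma mixed_volume_two_cells:
  fixes A :: "nat \<Rightarrow> 'a::euclidean_space set"
  assumes fin: "\<And>i. i < DIM('a) \<Longrightarrow> finite (A i) \<and> A i \<noteq> {}" and "y \<noteq> z"
  shows "mixed_volume (\<lambda>i. convex hull (cell (w i) (A i) y)) + mixed_volume (\<lambda>i. convex hull (cell (w i) (A i) z))
    \<le> mixed_volume (\<lambda>i. convex hull (A i))"
proof -
  let ?S = "breakpoints w A \<union> {y, z}"
  have finS: "finite ?S" using finite_breakpoints[of A w] fin by auto
  have "mixed_volume (\<lambda>i. convex hull (cell (w i) (A i) y)) + mixed_volume (\<lambda>i. convex hull (cell (w i) (A i) z))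
      = (\<Sum>y\<in>{y, z}. mixed_volume (\<lambda>i. convex hull (cell (w i) (A i) y)))"
    using \<open>y \<noteq> z\<close> by simp
  also have "\<dots> \<le> (\<Sum>y\<in>?S. mixed_volume (\<lambda>i. convex hull (cell (w i) (A i) y)))"
    using finS mixed_volume_cell_nonneg[where A=A and w=w, OF fin] by (intro sum_mono2) auto
  also have "\<dots> = mixed_volume (\<lambda>i. convex hull (A i))"
    using mixed_volume_subdivision[where A=A and w=w, OF fin finS] by (metis sup_ge1)
  finally show ?thesis .
qed

text \<open>The terms at slopes other than \<open>z\<close> have a positive sum, so one of them is
  positive.\<close>

lemma mixed_volume_cell_less:
  fixes A :: "nat \<Rightarrow> 'a::euclidean_space set"
  assumes fin: "\<And>i. i < DIM('a) \<Longrightarrow> finite (A i) \<and> A i \<noteq> {}"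
    and less: "mixed_volume (\<lambda>i. convex hull (cell (w i) (A i) z)) < mixed_volume (\<lambda>i. convex hull (A i))"
  obtains y where "y \<noteq> z" "0 < mixed_volume (\<lambda>i. convex hull (cell (w i) (A i) y))"
proof -
  let ?S = "insert z (breakpoints w A)"
  let ?V = "\<lambda>y. mixed_volume (\<lambda>i. convex hull (cell (w i) (A i) y))"
  have finS: "finite ?S" using finite_breakpoints[of A w] fin by auto
  have "mixed_volume (\<lambda>i. convex hull (A i)) = ?V z + (\<Sum>y\<in>?S - {z}. ?V y)"
    using mixed_volume_subdivision[where A=A and w=w, OF fin finS] finS by (subst sum.remove[symmetric]) auto
  then have "0 < (\<Sum>y\<in>?S - {z}. ?V y)" using less by simp
  then obtain y where "y \<in> ?S - {z}" "0 < ?V y"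
    by (metis (no_types, lifting) not_less sum_nonpos)
  then show ?thesis using that by blast
qed

section \<open>Monotonicity for polytopes\<close>

lemma polytope_family_hulls:
  fixes n :: nat
  assumes "\<And>i. i < n \<Longrightarrow> polytope (K i) \<and> K i \<noteq> {}"
  obtains A where "\<And>i. i < n \<Longrightarrow> finite (A i) \<and> A i \<noteq> {}" "\<And>i. i < n \<Longrightarrow> K i = convex hull (A i)"
proof -
  have "\<exists>A. i < n \<longrightarrow> finite A \<and> A \<noteq> {} \<and> K i = convex hull A" for i
    using assms[of i] unfolding polytope_def by (metis convex_hull_empty)
  then obtain A where "\<And>i. i < n \<longrightarrow> finite (A i) \<and> A i \<noteq> {} \<and> K i = convex hull (A i)" by metis
  then show ?thesis by (intro that[of A]) simp_all
qed

text \<open>At slope 0 the cell consists of the points of least weight, which are those of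
  \<open>A i\<close>, and adding \<open>A i\<close> to \<open>B i\<close> leaves the hull of
  \<open>B i\<close> unchanged. The first two claims also serve the strict comparison.\<close>

lemma mixed_volume_mono_hulls:
  fixes A B :: "nat \<Rightarrow> 'a::euclidean_space set"
  assumes A: "\<And>i. i < DIM('a) \<Longrightarrow> finite (A i) \<and> A i \<noteq> {}"
    and B: "\<And>i. i < DIM('a) \<Longrightarrow> finite (B i)"
    and sub: "\<And>i. i < DIM('a) \<Longrightarrow> convex hull (A i) \<subseteq> convex hull (B i)"
  defines "C \<equiv> \<lambda>i. A i \<union> B i" and "w \<equiv> \<lambda>i a. if a \<in> A i then 0 else 1"
  shows "mixed_volume (\<lambda>i. convex hull (C i)) = mixed_volume (\<lambda>i. convex hull (B i))"
    and "mixed_volume (\<lambda>i. convex hull (cell (w i) (C i) 0)) = mixed_volume (\<lambda>i. convex hull (A i))"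
    and "mixed_volume (\<lambda>i. convex hull (A i)) \<le> mixed_volume (\<lambda>i. convex hull (B i))"
proof -
  have finC: "finite (C i) \<and> C i \<noteq> {}" if "i < DIM('a)" for i
    using A[OF that] B[OF that] by (auto simp: C_def)
  have "convex hull (C i) = convex hull (B i)" if "i < DIM('a)" for i
  proof
    have "A i \<subseteq> convex hull (B i)" using sub[OF that] hull_subset[of "A i" convex] by blast
    then show "convex hull (C i) \<subseteq> convex hull (B i)"
      unfolding C_def by (intro hull_minimal) (auto intro: hull_inc)
    show "convex hull (B i) \<subseteq> convex hull (C i)" unfolding C_def by (intro hull_mono) auto
  qed
  then show C: "mixed_volume (\<lambda>i. convex hull (C i)) = mixed_volume (\<lambda>i. convex hull (B i))"
    by (rule mixed_volume_cong)
  have "cell (w i) (C i) 0 = A i" if "i < DIM('a)" for i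
    using A[OF that] by (auto simp: cell_def C_def w_def split: if_splits)
  then show cell0: "mixed_volume (\<lambda>i. convex hull (cell (w i) (C i) 0)) = mixed_volume (\<lambda>i. convex hull (A i))"
    by (intro mixed_volume_cong) simp
  \<comment> \<open>Any nonzero slope can play the second one; its nonnegative contribution is then
    dropped.\<close>
  obtain e :: 'a where "e \<noteq> 0" using nonempty_Basis nonzero_Basis by blast
  then show "mixed_volume (\<lambda>i. convex hull (A i)) \<le> mixed_volume (\<lambda>i. convex hull (B i))"
    using mixed_volume_two_cells[of C 0 e w, OF finC] mixed_volume_cell_nonneg[of C w e, OF finC]
    unfolding C cell0 by force
qed

lemma mixed_volume_mono:
  fixes K L :: "nat \<Rightarrow> 'a::euclidean_space set"
  assumes K: "\<And>i. i < DIM('a) \<Longrightarrow> polytope (K i) \<and> K i \<noteq> {}"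
    and L: "\<And>i. i < DIM('a) \<Longrightarrow> polytope (L i)"
    and sub: "\<And>i. i < DIM('a) \<Longrightarrow> K i \<subseteq> L i"
  shows "mixed_volume K \<le> mixed_volume L"
proof -
  have L': "polytope (L i) \<and> L i \<noteq> {}" if "i < DIM('a)" for i
    using K[OF that] L[OF that] sub[OF that] by auto
  obtain A where A: "\<And>i. i < DIM('a) \<Longrightarrow> finite (A i) \<and> A i \<noteq> {}"
      "\<And>i. i < DIM('a) \<Longrightarrow> K i = convex hull (A i)"
    by (rule polytope_family_hulls[of "DIM('a)" K, OF K]) (assumption, blast)
  obtain B where B: "\<And>i. i < DIM('a) \<Longrightarrow> finite (B i) \<and> B i \<noteq> {}"
      "\<And>i. i < DIM('a) \<Longrightarrow> L i = convex hull (B i)"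
    by (rule polytope_family_hulls[of "DIM('a)" L, OF L']) (assumption, blast)
  have "mixed_volume K = mixed_volume (\<lambda>i. convex hull (A i))"
    using A(2) by (intro mixed_volume_cong) auto
  also have "\<dots> \<le> mixed_volume (\<lambda>i. convex hull (B i))"
    using A B sub by (intro mixed_volume_mono_hulls(3)) auto
  also have "\<dots> = mixed_volume L"
    using B(2) by (intro mixed_volume_cong) auto
  finally show ?thesis .
qed

section \<open>Essential collections and strict monotonicity\<close>

text \<open>The modular law for dimensions of subspaces, applied to spans; it drives the exchange
  argument in Rado's theorem.\<close>

lemma dim_Un_span_Int:
  fixes U W :: "'a::euclidean_space set"
  shows "dim (U \<union> W) + dim (span U \<inter> span W) = dim U + dim W"
proof -
  have "span (U \<union> W) = {x + y |x y. x \<in> span U \<and> y \<in> span W}"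
    by (auto simp: span_Un)
  then have "dim (U \<union> W) = dim {x + y |x y. x \<in> span U \<and> y \<in> span W}"
    by (metis dim_span)
  then show ?thesis
    using dim_sums_Int[of "span U" "span W"] by simp
qed

text \<open>By submodularity of the rank, of two distinct elements of one set at least one can be removed.\<close>

theorem rado_independent_transversal:
  fixes B :: "nat \<Rightarrow> 'a::euclidean_space set"
  assumes "finite J" "\<And>i. i \<in> J \<Longrightarrow> finite (B i)"
    and "\<And>I. I \<subseteq> J \<Longrightarrow> card I \<le> dim (\<Union>i\<in>I. B i)"
  shows "\<exists>v. (\<forall>i\<in>J. v i \<in> B i) \<and> card J \<le> dim (v ` J)"
  using assms(2,3)
proof (induction "\<Sum>i\<in>J. card (B i)" arbitrary: B rule: less_induct)
  case less
  note finJ = assms(1) and finB = less.prems(1) and rk = less.prems(2)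
  show ?case
  proof (cases "\<exists>j\<in>J. \<exists>x\<in>B j. \<exists>y\<in>B j. x \<noteq> y")
    case False
    have "B i \<noteq> {}" if "i \<in> J" for i
      using rk[of "{i}"] that by auto
    then have "\<forall>i\<in>J. \<exists>v. B i = {v}" using False by blast
    then obtain v where v: "\<And>i. i \<in> J \<Longrightarrow> B i = {v i}" by metis
    then have "(\<Union>i\<in>J. B i) = v ` J" by auto
    then show ?thesis using rk[of J] v by (intro exI[of _ v]) auto
  next
    case True
    then obtain j x y where j: "j \<in> J" and xy: "x \<in> B j" "y \<in> B j" "x \<noteq> y" by blast
    \<comment> \<open>If there is no transversal, there is none after dropping \<open>z\<close> from
      \<open>B j\<close>, so by induction the rank condition fails for some index set. That set
      contains \<open>j\<close>, since the other sets are unchanged; \<open>I\<close> is the set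
      without \<open>j\<close>.\<close>
    have defect: "\<exists>I. I \<subseteq> J - {j} \<and> dim ((B j - {z}) \<union> (\<Union>i\<in>I. B i)) \<le> card I"
      if z: "z \<in> B j" and no: "\<not> (\<exists>v. (\<forall>i\<in>J. v i \<in> B i) \<and> card J \<le> dim (v ` J))" for z
    proof (rule ccontr)
      assume neg: "\<not> ?thesis"
      define B' where "B' = B(j := B j - {z})"
      have "\<exists>v. (\<forall>i\<in>J. v i \<in> B' i) \<and> card J \<le> dim (v ` J)"
      proof (rule less.hyps)
        have "card (B j - {z}) < card (B j)"
          using z finB[OF j] by (intro psubset_card_mono) auto
        then show "(\<Sum>i\<in>J. card (B' i)) < (\<Sum>i\<in>J. card (B i))"
          using j finJ by (intro sum_strict_mono_ex1) (auto simp: B'_def)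
        show "finite (B' i)" if "i \<in> J" for i using finB[OF that] by (auto simp: B'_def)
        show "card I \<le> dim (\<Union>i\<in>I. B' i)" if I: "I \<subseteq> J" for I
        proof (cases "j \<in> I")
          case True
          have "(\<Union>i\<in>I. B' i) = (B j - {z}) \<union> (\<Union>i\<in>I - {j}. B i)"
            using True by (auto simp: B'_def)
          moreover have "\<not> dim ((B j - {z}) \<union> (\<Union>i\<in>I - {j}. B i)) \<le> card (I - {j})"
            using neg I by blast
          moreover have "card I = Suc (card (I - {j}))"
            using card.remove[OF finite_subset[OF I finJ] True] .
          ultimately show ?thesis by simp
        next
          case False
          then have "(\<Union>i\<in>I. B' i) = (\<Union>i\<in>I. B i)"
            unfolding B'_def by (intro SUP_cong) auto
          then show ?thesis using rk[OF I] by simp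
        qed
      qed
      moreover have "B' i \<subseteq> B i" for i by (auto simp: B'_def)
      ultimately show False using no by blast
    qed
    show ?thesis
    proof (rule ccontr)
      assume no: "\<not> ?thesis"
      obtain I1 where I1: "I1 \<subseteq> J - {j}" "dim ((B j - {x}) \<union> (\<Union>i\<in>I1. B i)) \<le> card I1"
        using defect[OF xy(1) no] by blast
      obtain I2 where I2: "I2 \<subseteq> J - {j}" "dim ((B j - {y}) \<union> (\<Union>i\<in>I2. B i)) \<le> card I2"
        using defect[OF xy(2) no] by blast
      \<comment> \<open>As \<open>x \<noteq> y\<close>, the union of \<open>?U\<close> and
        \<open>?W\<close> contains all of \<open>B j\<close>, and both spans contain the sets
        indexed by \<open>I1 \<inter> I2\<close>. The rank bounds for union and intersection add up
        to one more than \<open>card I1 + card I2\<close>, against the modular law.\<close>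
      let ?U = "(B j - {x}) \<union> (\<Union>i\<in>I1. B i)" and ?W = "(B j - {y}) \<union> (\<Union>i\<in>I2. B i)"
      have fin: "finite I1" "finite I2" using I1(1) I2(1) finJ finite_subset by blast+
      have "?U \<union> ?W = (\<Union>i\<in>insert j (I1 \<union> I2). B i)" using xy by auto
      moreover have "card (insert j (I1 \<union> I2)) \<le> dim (\<Union>i\<in>insert j (I1 \<union> I2). B i)"
        using I1(1) I2(1) j by (intro rk) auto
      moreover have "card (insert j (I1 \<union> I2)) = Suc (card (I1 \<union> I2))"
        using I1(1) I2(1) fin by (subst card_insert_disjoint) auto
      ultimately have 1: "Suc (card (I1 \<union> I2)) \<le> dim (?U \<union> ?W)" by simp
      have "card (I1 \<inter> I2) \<le> dim (\<Union>i\<in>I1 \<inter> I2. B i)"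
        using I1(1) by (intro rk) auto
      also have "\<dots> \<le> dim (span ?U \<inter> span ?W)"
        by (intro dim_subset) (auto intro: span_base)
      finally have 2: "card (I1 \<inter> I2) \<le> dim (span ?U \<inter> span ?W)" .
      show False
        using 1 2 dim_Un_span_Int[of ?U ?W] I1(2) I2(2) card_Un_Int[OF fin] by linarith
    qed
  qed
qed

text \<open>Exchanging the single summand \<open>p i\<close> of the base point \<open>s\<close> for
  \<open>a\<close> moves \<open>s\<close> by \<open>a - p i\<close>. Hence the sum translated by
  \<open>- s\<close> and the differences span the same subspace.\<close>

lemma aff_dim_set_sum:
  fixes K :: "nat \<Rightarrow> 'a::euclidean_space set"
  assumes fin: "finite I" and ne: "\<And>i. i \<in> I \<Longrightarrow> K i \<noteq> {}"
  shows "aff_dim (\<Sum>i\<in>I. K i) = int (dim (differences I K))"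
proof -
  have "\<forall>i. \<exists>q. i \<in> I \<longrightarrow> q \<in> K i" using ne by blast
  then obtain p where p: "\<And>i. i \<in> I \<Longrightarrow> p i \<in> K i" by metis
  let ?S = "\<Sum>i\<in>I. K i"
  define s where "s = (\<Sum>i\<in>I. p i)"
  have mem: "x \<in> ?S \<longleftrightarrow> (\<exists>q. x = sum q I \<and> (\<forall>i\<in>I. q i \<in> K i))" for x
    by (auto simp: set_sum_alt[OF fin])
  have s: "s \<in> ?S" unfolding mem s_def using p by blast
  have "span ((\<lambda>x. x - s) ` ?S) = span (differences I K)"
  proof (rule span_eq[THEN iffD2], rule conjI)
    show "(\<lambda>x. x - s) ` ?S \<subseteq> span (differences I K)"
    proof
      fix y assume "y \<in> (\<lambda>x. x - s) ` ?S"
      then obtain x where "x \<in> ?S" "y = x - s" by blast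
      then obtain q where q: "y = sum q I - s" "\<forall>i\<in>I. q i \<in> K i" unfolding mem by blast
      have "y = (\<Sum>i\<in>I. q i - p i)" by (simp add: q s_def sum_subtractf)
      also have "\<dots> \<in> span (differences I K)"
        using q p by (intro span_sum span_base) (force simp: differences_def)
      finally show "y \<in> span (differences I K)" .
    qed
    have step: "a - p i \<in> (\<lambda>x. x - s) ` ?S" if "i \<in> I" "a \<in> K i" for i a
    proof -
      have "sum (p(i := a)) (I - {i}) = sum p (I - {i})" by (intro sum.cong) auto
      then have "sum (p(i := a)) I = s + (a - p i)"
        using sum.remove[OF fin that(1), of p] sum.remove[OF fin that(1), of "p(i := a)"]
        by (simp add: s_def)
      moreover have "sum (p(i := a)) I \<in> ?S" unfolding mem using p that by (intro exI[of _ "p(i := a)"]) auto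
      ultimately show ?thesis by (metis add_diff_cancel_left' image_eqI)
    qed
    show "differences I K \<subseteq> span ((\<lambda>x. x - s) ` ?S)"
    proof
      fix y assume "y \<in> differences I K"
      then obtain i a b where i: "i \<in> I" "a \<in> K i" "b \<in> K i" "y = (a - p i) - (b - p i)"
        by (auto simp: differences_def)
      show "y \<in> span ((\<lambda>x. x - s) ` ?S)"
        unfolding i(4) using step i by (intro span_diff[of "a - p i"] span_base) auto
    qed
  qed
  then have "dim ((\<lambda>x. x - s) ` ?S) = dim (differences I K)" by (metis dim_span)
  then show ?thesis using aff_dim_eq_dim_subtract[OF hull_inc[OF s]] by simp
qed

text \<open>Brings essentiality into the form of the rank condition in Rado's theorem.\<close>

lemma essential_iff_dim_differences:
  fixes K :: "nat \<Rightarrow> 'a::euclidean_space set"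
  assumes ne: "\<And>i. i < DIM('a) \<Longrightarrow> K i \<noteq> {}"
  shows "essential {..<DIM('a)} K \<longleftrightarrow> (\<forall>I\<subseteq>{..<DIM('a)}. card I \<le> dim (differences I K))"
proof -
  have "card I \<le> DIM('a) \<and> aff_dim (\<Sum>i\<in>I. K i) = int (dim (differences I K))" if I: "I \<subseteq> {..<DIM('a)}" for I
    using card_mono[OF finite_lessThan I] aff_dim_set_sum[of I K] I finite_subset[OF I] ne by auto
  then show ?thesis unfolding essential_def by auto
qed

text \<open>One direction is Rado's theorem. For the other, discarding the directions with index
  outside \<open>I\<close> lowers the rank \<open>DIM('a)\<close> by at most
  \<open>DIM('a) - card I\<close>.\<close>

lemma essential_iff_spanning_segments:
  fixes K :: "nat \<Rightarrow> 'a::euclidean_space set"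
  assumes ne: "\<And>i. i < DIM('a) \<Longrightarrow> K i \<noteq> {}"
  shows "essential {..<DIM('a)} K \<longleftrightarrow> spanning_segments K"
proof
  assume ess: "essential {..<DIM('a)} K"
  \<comment> \<open>Rado's theorem is available for finite sets, so each difference set is replaced
    by a basis drawn from it; the transversal then still consists of differences of points of the
    \<open>K i\<close>.\<close>
  have "\<exists>B. B \<subseteq> differences {i} K \<and> finite B \<and> differences {i} K \<subseteq> span B" for i
    by (metis basis_exists[of "differences {i} K"] finiteI_independent)
  then obtain B where B: "\<And>i. B i \<subseteq> differences {i} K" "\<And>i. finite (B i)" "\<And>i. differences {i} K \<subseteq> span (B i)"
    by metis
  have "\<exists>v. (\<forall>i\<in>{..<DIM('a)}. v i \<in> B i) \<and> card {..<DIM('a)} \<le> dim (v ` {..<DIM('a)})"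
  proof (rule rado_independent_transversal)
    fix I assume I: "I \<subseteq> {..<DIM('a)}"
    have "differences I K \<subseteq> span (\<Union>i\<in>I. B i)"
    proof
      fix x assume "x \<in> differences I K"
      then obtain i where i: "i \<in> I" "x \<in> differences {i} K" by (auto simp: differences_def)
      then have "x \<in> span (B i)" using B(3) by blast
      also have "\<dots> \<subseteq> span (\<Union>i\<in>I. B i)" using i by (intro span_mono) auto
      finally show "x \<in> span (\<Union>i\<in>I. B i)" .
    qed
    then have "dim (differences I K) \<le> dim (\<Union>i\<in>I. B i)" by (rule dim_mono)
    moreover have "card I \<le> dim (differences I K)" using ess I by (simp add: essential_iff_dim_differences[OF ne])
    ultimately show "card I \<le> dim (\<Union>i\<in>I. B i)" by linarith
  qed (use B in auto)
  then obtain v where v: "\<forall>i<DIM('a). v i \<in> B i" "DIM('a) \<le> dim (v ` {..<DIM('a)})" by auto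
  have "\<exists>p q. p \<in> K i \<and> q \<in> K i \<and> v i = p - q" if "i < DIM('a)" for i
  proof -
    have "v i \<in> differences {i} K" using v(1) B(1) that by blast
    then show ?thesis by (auto simp: differences_def)
  qed
  then have "\<forall>i. \<exists>p q. i < DIM('a) \<longrightarrow> p \<in> K i \<and> q \<in> K i \<and> v i = p - q" by blast
  then obtain p q where pq: "\<And>i. i < DIM('a) \<Longrightarrow> p i \<in> K i \<and> q i \<in> K i \<and> v i = p i - q i" by metis
  then have "(\<lambda>i. p i - q i) ` {..<DIM('a)} = v ` {..<DIM('a)}" by (intro image_cong) auto
  moreover have "span (v ` {..<DIM('a)}) = UNIV"
    using v(2) dim_subset_UNIV[of "v ` {..<DIM('a)}"] by (intro dim_eq_full[THEN iffD1]) simp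
  ultimately show "spanning_segments K"
    unfolding spanning_segments_def using pq by (intro exI[of _ p] exI[of _ q]) auto
next
  assume "spanning_segments K"
  then obtain p q where pq: "\<forall>i<DIM('a). p i \<in> K i \<and> q i \<in> K i"
      "span ((\<lambda>i. p i - q i) ` {..<DIM('a)}) = UNIV"
    unfolding spanning_segments_def by blast
  define v where "v = (\<lambda>i. p i - q i)"
  have "card I \<le> dim (differences I K)" if I: "I \<subseteq> {..<DIM('a)}" for I
  proof -
    have "v ` I \<union> v ` ({..<DIM('a)} - I) = v ` {..<DIM('a)}" using I by blast
    then have "DIM('a) = dim (v ` I \<union> v ` ({..<DIM('a)} - I))"
      using pq(2) dim_eq_full[of "v ` {..<DIM('a)}"] by (simp add: v_def)
    also have "\<dots> \<le> dim (v ` I) + dim (v ` ({..<DIM('a)} - I))"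
      using dim_Un_span_Int[of "v ` I" "v ` ({..<DIM('a)} - I)"] by simp
    also have "dim (v ` ({..<DIM('a)} - I)) \<le> card (v ` ({..<DIM('a)} - I))"
      by (intro dim_le_card') auto
    also have "\<dots> \<le> card ({..<DIM('a)} - I)" by (intro card_image_le) auto
    also have "\<dots> = DIM('a) - card I" using I finite_subset[OF I] by (simp add: card_Diff_subset)
    finally have "DIM('a) \<le> dim (v ` I) + (DIM('a) - card I)" by simp
    moreover have "card I \<le> DIM('a)" using card_mono[OF finite_lessThan I] by simp
    moreover have "dim (v ` I) \<le> dim (differences I K)"
    proof (intro dim_subset image_subsetI)
      show "v i \<in> differences I K" if "i \<in> I" for i
        using that I pq(1) by (force simp: differences_def v_def)
    qed
    ultimately show ?thesis by linarith
  qed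
  then show "essential {..<DIM('a)} K" by (simp add: essential_iff_dim_differences[OF ne])
qed

text \<open>The sum of the segments is a parallelotope whose volume equals the mixed volume. It is
  convex and full-dimensional, so it has interior points.\<close>

lemma mixed_volume_segments_pos:
  fixes p q :: "nat \<Rightarrow> 'a::euclidean_space"
  assumes span: "span ((\<lambda>i. p i - q i) ` {..<DIM('a)}) = UNIV"
  shows "0 < mixed_volume (\<lambda>i. convex hull {p i, q i})"
proof -
  define A where "A = (\<lambda>i. {p i, q i})"
  have fin: "finite (A i) \<and> A i \<noteq> {}" if "i < DIM('a)" for i by (simp add: A_def)
  have "(\<lambda>i. p i - q i) ` {..<DIM('a)} \<subseteq> differences {..<DIM('a)} A"
    by (force simp: differences_def A_def)
  then have spanA: "span (differences {..<DIM('a)} A) = UNIV" using span span_mono by blast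
  have card: "card (A i) - 1 = 1" if i: "i < DIM('a)" for i
  proof -
    have "p i \<noteq> q i"
    proof
      assume "p i = q i"
      \<comment> \<open>A zero difference would leave at most \<open>DIM('a) - 1\<close> vectors to
        span the space.\<close>
      then have "(\<lambda>i. p i - q i) ` {..<DIM('a)} \<subseteq> insert 0 ((\<lambda>i. p i - q i) ` ({..<DIM('a)} - {i}))" by auto
      then have "UNIV \<subseteq> span (insert 0 ((\<lambda>i. p i - q i) ` ({..<DIM('a)} - {i})))"
        using span span_mono by metis
      then have "DIM('a) \<le> card ((\<lambda>i. p i - q i) ` ({..<DIM('a)} - {i}))"
        using dim_le_card[of UNIV "(\<lambda>i. p i - q i) ` ({..<DIM('a)} - {i})"] by (simp add: span_insert_0)
      also have "\<dots> \<le> card ({..<DIM('a)} - {i})" by (intro card_image_le) auto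
      also have "\<dots> < DIM('a)" using i by (simp add: card_Diff_singleton)
      finally show False by simp
    qed
    then show ?thesis by (simp add: A_def)
  qed
  then have one: "(\<lambda>i. if i < DIM('a) then 1 else 0) = (\<lambda>i. if i < DIM('a) then card (A i) - 1 else 0)"
    by auto
  have "(\<Sum>i<DIM('a). card (A i) - 1) = DIM('a)" using card by simp
  then have "mixed_volume (\<lambda>i. convex hull (A i)) = measure lebesgue (msum (\<lambda>_. 1) (\<lambda>i. convex hull (A i)))"
    using mixed_volume_eq[OF vol_coeffs_simplices[where A=A, OF fin spanA]] one by simp
  moreover have "0 < measure lebesgue (msum (\<lambda>_. 1) (\<lambda>i. convex hull (A i)))"
  proof -
    let ?S = "msum (\<lambda>_. 1) (\<lambda>i. convex hull (A i))"
    have cvx: "convex ?S" by (intro convex_msum) auto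
    have cpt: "compact ?S" using fin by (intro compact_msum finite_imp_compact_convex_hull) auto
    have "span (differences {..<DIM('a)} (\<lambda>i. convex hull (A i))) = UNIV"
      using spanA span_mono[OF differences_mono[of "{..<DIM('a)}" A "\<lambda>i. convex hull (A i)"]]
      by (auto simp: hull_subset)
    then have "dim (differences {..<DIM('a)} (\<lambda>i. convex hull (A i))) = DIM('a)" by (simp add: dim_eq_full)
    then have "aff_dim ?S = int DIM('a)"
      using aff_dim_set_sum[of "{..<DIM('a)}" "\<lambda>i. convex hull (A i)"] by (simp add: msum_def A_def)
    then have "affine hull ?S = UNIV" by (simp add: aff_dim_eq_full)
    then have "interior ?S = rel_interior ?S" by (simp add: rel_interior_interior)
    moreover have "?S \<noteq> {}" using \<open>affine hull ?S = UNIV\<close> by auto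
    ultimately have "interior ?S \<noteq> {}" using cvx by (simp add: rel_interior_eq_empty)
    then have "\<not> negligible ?S" using negligible_convex_interior[OF cvx] by simp
    then show ?thesis
      using cpt by (simp add: lmeasurable_compact negligible_iff_measure zero_less_measure_iff)
  qed
  ultimately show ?thesis by (simp add: A_def)
qed

text \<open>By monotonicity it suffices to find spanning segments inside the
  \<open>K i\<close>.\<close>

lemma essential_imp_mixed_volume_pos:
  fixes K :: "nat \<Rightarrow> 'a::euclidean_space set"
  assumes K: "\<And>i. i < DIM('a) \<Longrightarrow> polytope (K i) \<and> K i \<noteq> {}" and "essential {..<DIM('a)} K"
  shows "0 < mixed_volume K"
proof -
  have "spanning_segments K"
    using assms(2) by (subst (asm) essential_iff_spanning_segments) (use K in auto)
  then obtain p q where pq: "\<forall>i<DIM('a). p i \<in> K i \<and> q i \<in> K i"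
      "span ((\<lambda>i. p i - q i) ` {..<DIM('a)}) = UNIV"
    unfolding spanning_segments_def by blast
  have "0 < mixed_volume (\<lambda>i. convex hull {p i, q i})"
    by (rule mixed_volume_segments_pos[OF pq(2)])
  also have "\<dots> \<le> mixed_volume K"
  proof (rule mixed_volume_mono)
    show "convex hull {p i, q i} \<subseteq> K i" if "i < DIM('a)" for i
      using pq(1) K that by (intro hull_minimal polytope_imp_convex) auto
  qed (use K in \<open>auto intro: polytope_convex_hull\<close>)
  finally show ?thesis .
qed

section \<open>Faces and the two directions of the criterion\<close>

lemma mem_face_dir_iff:
  assumes "compact K"
  shows "x \<in> face_dir K u \<longleftrightarrow> x \<in> K \<and> (\<forall>y\<in>K. u \<bullet> y \<le> u \<bullet> x)"
proof
  assume x: "x \<in> face_dir K u"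
  have "bdd_above ((\<lambda>x. u \<bullet> x) ` K)"
    using assms by (intro bounded_imp_bdd_above compact_imp_bounded compact_continuous_image continuous_intros)
  then have "u \<bullet> y \<le> support_fn K u" if "y \<in> K" for y
    unfolding support_fn_def using that by (intro cSup_upper) auto
  then show "x \<in> K \<and> (\<forall>y\<in>K. u \<bullet> y \<le> u \<bullet> x)" using x by (auto simp: face_dir_def)
next
  assume x: "x \<in> K \<and> (\<forall>y\<in>K. u \<bullet> y \<le> u \<bullet> x)"
  then have "support_fn K u = u \<bullet> x"
    unfolding support_fn_def by (intro cSup_eq_maximum) auto
  then show "x \<in> face_dir K u" using x by (simp add: face_dir_def)
qed

lemma face_dir_nonempty:
  assumes "compact K" "K \<noteq> {}"
  shows "face_dir K u \<noteq> {}"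
proof -
  have "\<exists>x\<in>K. \<forall>y\<in>K. u \<bullet> y \<le> u \<bullet> x"
    by (intro continuous_attains_sup assms continuous_intros)
  then obtain x where "x \<in> K" "\<forall>y\<in>K. u \<bullet> y \<le> u \<bullet> x" by blast
  then have "x \<in> face_dir K u" using mem_face_dir_iff[OF assms(1)] by blast
  then show ?thesis by blast
qed

text \<open>A point cut off by a hyperplane strictly through \<open>K\<close> can be pulled towards a point \<open>q\<close> above
  the hyperplane without changing the direction of its difference to \<open>q\<close>.\<close>

lemma differences_subset_span_upper_part:
  fixes K :: "'a::euclidean_space set"
  assumes "convex K" and q: "q \<in> K" "c < u \<bullet> q" and ab: "a \<in> K" "b \<in> K"
    and V: "\<And>x y. \<lbrakk>x \<in> K; y \<in> K; c \<le> u \<bullet> x; c \<le> u \<bullet> y\<rbrakk> \<Longrightarrow> x - y \<in> V"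
  shows "a - b \<in> span V"
proof -
  have *: "x - q \<in> span V" if x: "x \<in> K" for x
  proof -
    have "((\<lambda>t. u \<bullet> ((1 - t) *\<^sub>R q + t *\<^sub>R x)) \<longlongrightarrow> u \<bullet> ((1 - 0) *\<^sub>R q + 0 *\<^sub>R x)) (at_right 0)"
      by (intro tendsto_intros)
    then have "eventually (\<lambda>t. c < u \<bullet> ((1 - t) *\<^sub>R q + t *\<^sub>R x)) (at_right 0)"
      by (rule order_tendstoD(1)) (use q in simp)
    moreover have "eventually (\<lambda>t::real. 0 < t \<and> t < 1) (at_right 0)"
      using eventually_at_right_less[of 0] eventually_at_right_field[of "\<lambda>t. t < 1" 0]
      by (auto intro!: eventually_conj exI[of _ 1])
    ultimately have "eventually (\<lambda>t. (0 < t \<and> t < 1) \<and> c < u \<bullet> ((1 - t) *\<^sub>R q + t *\<^sub>R x)) (at_right 0)"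
      by eventually_elim simp
    then obtain t where t: "0 < t" "t < 1" "c < u \<bullet> ((1 - t) *\<^sub>R q + t *\<^sub>R x)"
      using eventually_happens trivial_limit_at_right_real by force
    have "(1 - t) *\<^sub>R q + t *\<^sub>R x \<in> K"
      using assms(1) q x t by (intro convexD) auto
    then have "((1 - t) *\<^sub>R q + t *\<^sub>R x) - q \<in> V"
      using t q by (intro V) auto
    moreover have "((1 - t) *\<^sub>R q + t *\<^sub>R x) - q = t *\<^sub>R (x - q)" by (simp add: algebra_simps)
    ultimately have "t *\<^sub>R (x - q) \<in> V" by simp
    from span_scale[OF span_base[OF this], of "1 / t"] show ?thesis using t by simp
  qed
  have "(a - q) - (b - q) \<in> span V" using * ab by (intro span_diff[of "a - q"]) auto
  then show ?thesis by simp
qed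

text \<open>Enlarging the sets preserves spanning segments, so it suffices to place the cells of one
  nonzero slope with positive mixed volume inside the prescribed faces or bodies.\<close>

lemma strict_mono_imp_essential:
  fixes P Q :: "nat \<Rightarrow> 'a::euclidean_space set"
  assumes P: "\<And>i. i < DIM('a) \<Longrightarrow> polytope (P i) \<and> P i \<noteq> {}"
    and Q: "\<And>i. i < DIM('a) \<Longrightarrow> polytope (Q i)"
    and sub: "\<And>i. i < DIM('a) \<Longrightarrow> P i \<subseteq> Q i"
    and less: "mixed_volume P < mixed_volume Q"
  shows "\<exists>u \<in> sphere 0 1. essential {..<DIM('a)}
       (\<lambda>i. if P i \<inter> face_dir (Q i) u \<noteq> {} then face_dir (Q i) u else Q i)"
proof -
  have Q': "polytope (Q i) \<and> Q i \<noteq> {}" if "i < DIM('a)" for i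
    using P[OF that] Q[OF that] sub[OF that] by auto
  obtain A where A: "\<And>i. i < DIM('a) \<Longrightarrow> finite (A i) \<and> A i \<noteq> {}"
      "\<And>i. i < DIM('a) \<Longrightarrow> P i = convex hull (A i)"
    by (rule polytope_family_hulls[of "DIM('a)" P, OF P]) (assumption, blast)
  obtain B where B: "\<And>i. i < DIM('a) \<Longrightarrow> finite (B i) \<and> B i \<noteq> {}"
      "\<And>i. i < DIM('a) \<Longrightarrow> Q i = convex hull (B i)"
    by (rule polytope_family_hulls[of "DIM('a)" Q, OF Q']) (assumption, blast)
  define C where "C = (\<lambda>i. A i \<union> B i)"
  define w where "w = (\<lambda>i a. if a \<in> A i then 0 else 1 :: real)"
  have finC: "finite (C i) \<and> C i \<noteq> {}" if "i < DIM('a)" for i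
    using A(1)[of i] B(1)[of i] that by (auto simp: C_def)
  have "mixed_volume P = mixed_volume (\<lambda>i. convex hull (A i))"
    using A(2) by (intro mixed_volume_cong) auto
  moreover have "mixed_volume Q = mixed_volume (\<lambda>i. convex hull (B i))"
    using B(2) by (intro mixed_volume_cong) auto
  moreover have AB: "convex hull (A i) \<subseteq> convex hull (B i)" if "i < DIM('a)" for i
    using sub[OF that] A(2)[OF that] B(2)[OF that] by simp
  have "mixed_volume (\<lambda>i. convex hull (C i)) = mixed_volume (\<lambda>i. convex hull (B i))"
    unfolding C_def by (rule mixed_volume_mono_hulls(1)[where A=A and B=B]) (use A(1) B(1) AB in blast)+
  moreover have "mixed_volume (\<lambda>i. convex hull (cell (w i) (C i) 0)) = mixed_volume (\<lambda>i. convex hull (A i))"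
    unfolding C_def w_def
    by (rule mixed_volume_mono_hulls(2)[where A=A and B=B]) (use A(1) B(1) AB in blast)+
  ultimately have "mixed_volume (\<lambda>i. convex hull (cell (w i) (C i) 0)) < mixed_volume (\<lambda>i. convex hull (C i))"
    using less by simp
  then obtain y where y: "y \<noteq> 0" "0 < mixed_volume (\<lambda>i. convex hull (cell (w i) (C i) y))"
    using mixed_volume_cell_less[where A=C and w=w and z=0, OF finC] by blast
  have segs: "spanning_segments (\<lambda>i. cell (w i) (C i) y)"
  proof (rule mixed_volume_pos_imp_spanning_segments[OF _ y(2)])
    show "finite (cell (w i) (C i) y) \<and> cell (w i) (C i) y \<noteq> {}" if "i < DIM('a)" for i
      using finC[OF that] cell_nonempty finite_subset[OF cell_subset] by blast
  qed
  define u where "u = y /\<^sub>R norm y"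
  have u: "u \<in> sphere 0 1" using y by (simp add: u_def)
  have yu: "y \<bullet> x = norm y * (u \<bullet> x)" for x using y by (simp add: u_def)
  let ?R = "\<lambda>i. if P i \<inter> face_dir (Q i) u \<noteq> {} then face_dir (Q i) u else Q i"
  \<comment> \<open>Points of \<open>A i\<close> have weight 0 and all weights are nonnegative, so a
    point of the cell is at least as high in direction \<open>u\<close> as all of
    \<open>P i\<close>. If \<open>P i\<close> meets the face, that point attains the maximum over
    \<open>Q i\<close>.\<close>
  have cellR: "cell (w i) (C i) y \<subseteq> ?R i" if i: "i < DIM('a)" for i
  proof
    fix a assume a: "a \<in> cell (w i) (C i) y"
    have cpt: "compact (Q i)" using Q[OF i] by (rule polytope_imp_compact)
    have "A i \<subseteq> Q i" "B i \<subseteq> Q i"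
      using sub[OF i] A(2)[of i] B(2)[of i] i hull_subset[of "A i" convex] hull_subset[of "B i" convex] by auto
    then have aQ: "a \<in> Q i" using a cell_subset[of "w i" "C i" y] by (auto simp: C_def)
    show "a \<in> ?R i"
    proof (cases "P i \<inter> face_dir (Q i) u = {}")
      case False
      then obtain z where z: "z \<in> P i" "z \<in> face_dir (Q i) u" by blast
      have "A i \<subseteq> {x. y \<bullet> x \<le> y \<bullet> a}"
      proof
        fix b assume b: "b \<in> A i"
        then have "y \<bullet> b - w i b \<le> y \<bullet> a - w i a" using a by (auto simp: cell_def C_def)
        moreover have "w i b = 0" "0 \<le> w i a" using b by (auto simp: w_def)
        ultimately show "b \<in> {x. y \<bullet> x \<le> y \<bullet> a}" by auto
      qed
      then have "P i \<subseteq> {x. y \<bullet> x \<le> y \<bullet> a}"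
        using A(2)[of i] i by (simp add: hull_minimal convex_halfspace_le)
      then have "u \<bullet> z \<le> u \<bullet> a" using z(1) y(1) by (auto simp: yu)
      moreover have "\<forall>x\<in>Q i. u \<bullet> x \<le> u \<bullet> z" using z(2) by (simp add: mem_face_dir_iff[OF cpt])
      ultimately have "a \<in> face_dir (Q i) u" using aQ by (auto simp: mem_face_dir_iff[OF cpt] intro: order_trans)
      then show ?thesis using False by simp
    qed (use aQ in simp)
  qed
  have segsR: "spanning_segments ?R" by (rule spanning_segments_mono[OF segs cellR])
  have Rne: "?R i \<noteq> {}" if "i < DIM('a)" for i
    using cellR[OF that] cell_nonempty[of "C i" "w i" y] finC[OF that] by blast
  have "essential {..<DIM('a)} ?R"
    by (rule essential_iff_spanning_segments[THEN iffD2, OF _ segsR]) (rule Rne)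
  then show ?thesis using u by (rule bexI)
qed

text \<open>Essentiality depends only on the directions present, so each face or body may be
  replaced by the part of \<open>Q i\<close> above a level \<open>c i\<close>, and this part fits
  into the hull of a cell of slope \<open>u\<close>.\<close>

lemma essential_imp_strict_mono:
  fixes P Q :: "nat \<Rightarrow> 'a::euclidean_space set"
  assumes P: "\<And>i. i < DIM('a) \<Longrightarrow> polytope (P i) \<and> P i \<noteq> {}"
    and Q: "\<And>i. i < DIM('a) \<Longrightarrow> polytope (Q i)"
    and sub: "\<And>i. i < DIM('a) \<Longrightarrow> P i \<subseteq> Q i"
    and u: "u \<in> sphere 0 1"
    and ess: "essential {..<DIM('a)} (\<lambda>i. if P i \<inter> face_dir (Q i) u \<noteq> {} then face_dir (Q i) u else Q i)"
  shows "mixed_volume P < mixed_volume Q"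
proof -
  let ?R = "\<lambda>i. if P i \<inter> face_dir (Q i) u \<noteq> {} then face_dir (Q i) u else Q i"
  have cpt: "compact (Q i)" "Q i \<noteq> {}" if "i < DIM('a)" for i
    using Q[OF that] P[OF that] sub[OF that] polytope_imp_compact by auto
  \<comment> \<open>If \<open>P i\<close> meets the face, \<open>c\<close> is the maximum over
    \<open>Q i\<close> and the upper part is the face. Otherwise \<open>c\<close> lies halfway
    between the maxima over \<open>P i\<close> and \<open>Q i\<close>, and the upper part still
    spans all directions of \<open>Q i\<close>.\<close>
  have "\<exists>c. (\<forall>x\<in>P i. u \<bullet> x \<le> c) \<and> (\<exists>q\<in>Q i. c \<le> u \<bullet> q) \<and>
      differences {i} ?R \<subseteq> span (differences {i} (\<lambda>i. Q i \<inter> {x. u \<bullet> x \<ge> c}))" if i: "i < DIM('a)" for i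
  proof (cases "P i \<inter> face_dir (Q i) u = {}")
    case False
    then obtain q where "q \<in> face_dir (Q i) u" by blast
    then have q: "q \<in> Q i" "\<forall>x\<in>Q i. u \<bullet> x \<le> u \<bullet> q" by (auto simp: mem_face_dir_iff[OF cpt(1)[OF i]])
    have "?R i \<subseteq> Q i \<inter> {x. u \<bullet> x \<ge> u \<bullet> q}"
      using False q by (auto simp: mem_face_dir_iff[OF cpt(1)[OF i]])
    then have "differences {i} ?R \<subseteq> differences {i} (\<lambda>i. Q i \<inter> {x. u \<bullet> x \<ge> u \<bullet> q})"
      by (intro differences_mono) (erule singletonE, hypsubst, assumption)
    then show ?thesis using q sub[OF i] span_superset by (intro exI[of _ "u \<bullet> q"]) blast
  next
    case True
    obtain q where "q \<in> face_dir (Q i) u" using face_dir_nonempty[OF cpt[OF i]] by blast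
    then have q: "q \<in> Q i" "\<forall>x\<in>Q i. u \<bullet> x \<le> u \<bullet> q" by (auto simp: mem_face_dir_iff[OF cpt(1)[OF i]])
    have "compact (P i)" using P[OF i] polytope_imp_compact by auto
    then obtain p where p: "p \<in> P i" "\<forall>x\<in>P i. u \<bullet> x \<le> u \<bullet> p"
      using face_dir_nonempty[of "P i" u] P[OF i] by (auto simp: mem_face_dir_iff)
    have "u \<bullet> p \<noteq> u \<bullet> q"
    proof
      assume "u \<bullet> p = u \<bullet> q"
      then have "p \<in> face_dir (Q i) u"
        unfolding mem_face_dir_iff[OF cpt(1)[OF i]] using p(1) q(2) sub[OF i] by auto
      with True p(1) show False by blast
    qed
    then have less: "u \<bullet> p < u \<bullet> q" using q(2) p(1) sub[OF i] by force
    define c where "c = (u \<bullet> p + u \<bullet> q) / 2"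
    have c: "u \<bullet> p < c" "c < u \<bullet> q" using less by (auto simp: c_def)
    have "differences {i} ?R \<subseteq> span (differences {i} (\<lambda>i. Q i \<inter> {x. u \<bullet> x \<ge> c}))"
    proof
      fix v assume "v \<in> differences {i} ?R"
      then obtain a b where "a \<in> Q i" "b \<in> Q i" "v = a - b" using True by (auto simp: differences_def)
      moreover have "x - y \<in> differences {i} (\<lambda>i. Q i \<inter> {x. u \<bullet> x \<ge> c})"
        if "x \<in> Q i" "y \<in> Q i" "c \<le> u \<bullet> x" "c \<le> u \<bullet> y" for x y
        using that by (force simp: differences_def)
      ultimately show "v \<in> span (differences {i} (\<lambda>i. Q i \<inter> {x. u \<bullet> x \<ge> c}))"
        using differences_subset_span_upper_part[OF polytope_imp_convex[OF Q[OF i]] q(1) c(2)] by blast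
    qed
    then show ?thesis using p c q by (intro exI[of _ c]) force
  qed
  then have "\<forall>i. \<exists>c. i < DIM('a) \<longrightarrow> (\<forall>x\<in>P i. u \<bullet> x \<le> c) \<and> (\<exists>q\<in>Q i. c \<le> u \<bullet> q) \<and>
      differences {i} ?R \<subseteq> span (differences {i} (\<lambda>i. Q i \<inter> {x. u \<bullet> x \<ge> c}))" by blast
  from choice[OF this] obtain c where c: "\<And>i x. i < DIM('a) \<Longrightarrow> x \<in> P i \<Longrightarrow> u \<bullet> x \<le> c i"
      "\<And>i. i < DIM('a) \<Longrightarrow> \<exists>q\<in>Q i. c i \<le> u \<bullet> q"
      "\<And>i. i < DIM('a) \<Longrightarrow> differences {i} ?R \<subseteq> span (differences {i} (\<lambda>j. Q j \<inter> {x. u \<bullet> x \<ge> c i}))"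
    by blast
  define L where "L = (\<lambda>i. Q i \<inter> {x. u \<bullet> x \<le> c i})"
  define U where "U = (\<lambda>i. Q i \<inter> {x. u \<bullet> x \<ge> c i})"
  have L: "polytope (L i) \<and> L i \<noteq> {}" if i: "i < DIM('a)" for i
    using Q[OF i] P[OF i] sub[OF i] c(1)[OF i] unfolding L_def
    by (intro conjI polytope_Int_polyhedron polyhedron_halfspace_le) auto
  have U: "polytope (U i) \<and> U i \<noteq> {}" if i: "i < DIM('a)" for i
    using Q[OF i] c(2)[OF i] unfolding U_def
    by (intro conjI polytope_Int_polyhedron polyhedron_halfspace_ge) auto
  have essR: "\<forall>I\<subseteq>{..<DIM('a)}. card I \<le> dim (differences I ?R)"
    by (rule essential_iff_dim_differences[THEN iffD1, OF _ ess]) (use cpt in auto)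
  have essU: "essential {..<DIM('a)} U"
  proof (subst essential_iff_dim_differences)
    show "U i \<noteq> {}" if "i < DIM('a)" for i using U[OF that] by simp
    show "\<forall>I\<subseteq>{..<DIM('a)}. card I \<le> dim (differences I U)"
    proof (intro allI impI)
      fix I assume I: "I \<subseteq> {..<DIM('a)}"
      have "differences I ?R \<subseteq> span (differences I U)"
      proof
        fix v assume "v \<in> differences I ?R"
        then obtain i where i: "i \<in> I" "v \<in> differences {i} ?R" unfolding differences_def by blast
        then have "v \<in> span (differences {i} U)"
          using c(3)[of i] I by (auto simp: U_def differences_def)
        also have "\<dots> \<subseteq> span (differences I U)" using i(1) by (intro span_mono) (auto simp: differences_def)
        finally show "v \<in> span (differences I U)" .
      qed
      then have "dim (differences I ?R) \<le> dim (differences I U)" by (rule dim_mono)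
      moreover have "card I \<le> dim (differences I ?R)"
        by (rule essR[rule_format, OF I])
      ultimately show "card I \<le> dim (differences I U)" by linarith
    qed
  qed
  obtain A where A: "\<And>i. i < DIM('a) \<Longrightarrow> finite (A i) \<and> A i \<noteq> {}"
      "\<And>i. i < DIM('a) \<Longrightarrow> L i = convex hull (A i)"
    by (rule polytope_family_hulls[of "DIM('a)" L, OF L]) (assumption, blast)
  obtain B where B: "\<And>i. i < DIM('a) \<Longrightarrow> finite (B i) \<and> B i \<noteq> {}"
      "\<And>i. i < DIM('a) \<Longrightarrow> U i = convex hull (B i)"
    by (rule polytope_family_hulls[of "DIM('a)" U, OF U]) (assumption, blast)
  define C where "C = (\<lambda>i. A i \<union> B i)"
  \<comment> \<open>At slope 0 the objective is minus the weight, maximal where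
    \<open>u \<bullet> a \<le> c i\<close>; at slope \<open>u\<close> it is the minimum of
    \<open>u \<bullet> a\<close> and \<open>c i\<close>, maximal where
    \<open>u \<bullet> a \<ge> c i\<close>.\<close>
  define w where "w = (\<lambda>i a. max 0 (u \<bullet> a - c i))"
  have finC: "finite (C i) \<and> C i \<noteq> {}" if "i < DIM('a)" for i
    using A(1)[of i] B(1)[of i] that by (auto simp: C_def)
  have AL: "A i \<subseteq> L i" and BU: "B i \<subseteq> U i" if "i < DIM('a)" for i
    using A(2)[of i] B(2)[of i] that hull_subset[of "A i" convex] hull_subset[of "B i" convex] by auto
  have hullC: "convex hull (C i) = Q i" if i: "i < DIM('a)" for i
  proof
    show "convex hull (C i) \<subseteq> Q i"
      using AL[OF i] BU[OF i] polytope_imp_convex[OF Q[OF i]] unfolding C_def L_def U_def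
      by (intro hull_minimal) auto
    have "L i \<union> U i \<subseteq> convex hull (C i)"
      using A(2)[of i] B(2)[of i] i hull_mono[of "A i" "C i"] hull_mono[of "B i" "C i"] by (auto simp: C_def)
    moreover have "Q i \<subseteq> L i \<union> U i" by (auto simp: L_def U_def)
    ultimately show "Q i \<subseteq> convex hull (C i)" by blast
  qed
  have cell0: "A i \<subseteq> cell (w i) (C i) 0" and cellu: "B i \<subseteq> cell (w i) (C i) u" if i: "i < DIM('a)" for i
    using AL[OF i] BU[OF i] by (auto simp: cell_def C_def w_def L_def U_def)
  have finCell: "finite (cell (w i) (C i) y)" if "i < DIM('a)" for i y
    using finC[OF that] finite_subset[OF cell_subset] by blast
  have "mixed_volume P \<le> mixed_volume (\<lambda>i. convex hull (cell (w i) (C i) 0))"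
  proof (rule mixed_volume_mono[OF P])
    fix i assume i: "i < DIM('a)"
    show "polytope (convex hull (cell (w i) (C i) 0))" using finCell[OF i] by (rule polytope_convex_hull)
    have "P i \<subseteq> L i" using sub[OF i] c(1)[OF i] by (auto simp: L_def)
    also have "\<dots> \<subseteq> convex hull (cell (w i) (C i) 0)" using A(2)[of i] i hull_mono[OF cell0[OF i]] by simp
    finally show "P i \<subseteq> convex hull (cell (w i) (C i) 0)" .
  qed
  moreover have "mixed_volume U \<le> mixed_volume (\<lambda>i. convex hull (cell (w i) (C i) u))"
  proof (rule mixed_volume_mono[OF U])
    fix i assume i: "i < DIM('a)"
    show "polytope (convex hull (cell (w i) (C i) u))" using finCell[OF i] by (rule polytope_convex_hull)
    show "U i \<subseteq> convex hull (cell (w i) (C i) u)" using B(2)[of i] i hull_mono[OF cellu[OF i]] by simp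
  qed
  moreover have "0 < mixed_volume U"
    using U essU by (rule essential_imp_mixed_volume_pos)
  moreover have "mixed_volume (\<lambda>i. convex hull (cell (w i) (C i) 0)) + mixed_volume (\<lambda>i. convex hull (cell (w i) (C i) u))
      \<le> mixed_volume (\<lambda>i. convex hull (C i))"
    by (rule mixed_volume_two_cells[where A=C and w=w, OF finC]) (use u in auto)
  moreover have "mixed_volume (\<lambda>i. convex hull (C i)) = mixed_volume Q"
    using hullC by (rule mixed_volume_cong)
  ultimately show ?thesis by linarith
qed

text \<open>Indexing the modified collection by \<open>i\<close> keeps multiplicities when faces or
  bodies coincide; the test in the \<open>if\<close> is membership of \<open>i\<close> in the set
  \<open>T_u\<close>.\<close>

theorem theorem3p3:
  fixes P Q :: "nat \<Rightarrow> 'a::euclidean_space set"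
  assumes "\<And>i. i < DIM('a) \<Longrightarrow> polytope (P i) \<and> P i \<noteq> {}"
    and "\<And>i. i < DIM('a) \<Longrightarrow> polytope (Q i)"
    and "\<And>i. i < DIM('a) \<Longrightarrow> P i \<subseteq> Q i"
  shows "mixed_volume P < mixed_volume Q \<longleftrightarrow>
    (\<exists>u \<in> sphere 0 1. essential {..<DIM('a)}
       (\<lambda>i. if P i \<inter> face_dir (Q i) u \<noteq> {} then face_dir (Q i) u else Q i))"
proof
  assume "mixed_volume P < mixed_volume Q"
  then show "\<exists>u \<in> sphere 0 1. essential {..<DIM('a)}
       (\<lambda>i. if P i \<inter> face_dir (Q i) u \<noteq> {} then face_dir (Q i) u else Q i)"
    by (rule strict_mono_imp_essential[where P=P and Q=Q, rotated 3]) (fact assms)+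
next
  assume "\<exists>u \<in> sphere 0 1. essential {..<DIM('a)}
       (\<lambda>i. if P i \<inter> face_dir (Q i) u \<noteq> {} then face_dir (Q i) u else Q i)"
  then obtain u where "u \<in> sphere 0 1" "essential {..<DIM('a)}
       (\<lambda>i. if P i \<inter> face_dir (Q i) u \<noteq> {} then face_dir (Q i) u else Q i)" by blast
  then show "mixed_volume P < mixed_volume Q"
    by (rule essential_imp_strict_mono[where P=P and Q=Q, rotated 3]) (fact assms)+
qed

end
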